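(* Up to projective equivalence, there is exactly one Rédei blocking set of index 3 and size 13 in $PG(2,7)$.
   Context: A (proper) blocking set in $PG(2,q)$ is a set $S$ of points meeting every line and containing no line. It is minimal if it does not properly contain a smaller blocking set. The index of $S$ is the minimum number of lines whose union contains $S$. A Rédei blocking set is a minimal blocking set with $q+n$ points for which the maximum number of its points on a line is $n$. Two blocking sets are projectively equivalent if some collineation of the plane maps one onto the other. *)

theory Defs
  imports "HOL-Analysis.Analysis"
begin

text \<open>
  The plane $PG(2,q)$ over a finite field \<open>'a\<close> with $q$ elements: points are the
  one-dimensional subspaces of \<open>'a ^ 3\<close>; a line is the set of points contained in a
  two-dimensional subspace. (The subspace notions are those of the interpretation \<open>vec\<close>
  of \<open>finite_dimensional_vector_space\<close>, with scalars in \<open>'a\<close>.)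
\<close>

definition pg_points :: "('a::{field,finite} ^ 3) set set" where
  "pg_points = {P. vec.subspace P \<and> vec.dim P = 1}"

definition pg_lines :: "('a::{field,finite} ^ 3) set set set" where
  "pg_lines = {{P \<in> pg_points. P \<subseteq> W} | W. vec.subspace W \<and> vec.dim W = 2}"

definition blocking_set :: "('a::{field,finite} ^ 3) set set \<Rightarrow> bool" where
  "blocking_set S \<longleftrightarrow>
     S \<subseteq> pg_points \<and> (\<forall>l \<in> pg_lines. S \<inter> l \<noteq> {}) \<and> (\<forall>l \<in> pg_lines. \<not> l \<subseteq> S)"

definition minimal_blocking_set :: "('a::{field,finite} ^ 3) set set \<Rightarrow> bool" where
  "minimal_blocking_set S \<longleftrightarrow> blocking_set S \<and> (\<forall>T. T \<subset> S \<longrightarrow> \<not> blocking_set T)"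

definition pg_index :: "('a::{field,finite} ^ 3) set set \<Rightarrow> nat" where
  "pg_index S = (LEAST k. \<exists>L. L \<subseteq> pg_lines \<and> card L = k \<and> S \<subseteq> \<Union> L)"

definition redei_blocking_set :: "('a::{field,finite} ^ 3) set set \<Rightarrow> bool" where
  "redei_blocking_set S \<longleftrightarrow> minimal_blocking_set S \<and>
     (\<exists>n. card S = CARD('a) + n \<and> Max ((\<lambda>l. card (S \<inter> l)) ` pg_lines) = n)"

text \<open>Only the values of a collineation on \<^term>\<open>pg_points\<close> are relevant.\<close>

definition collineation :: "(('a::{field,finite} ^ 3) set \<Rightarrow> ('a ^ 3) set) \<Rightarrow> bool" where
  "collineation f \<longleftrightarrow> bij_betw f pg_points pg_points \<and> (\<lambda>l. f ` l) ` pg_lines = pg_lines"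

definition proj_equivalent ::
    "('a::{field,finite} ^ 3) set set \<Rightarrow> ('a ^ 3) set set \<Rightarrow> bool" where
  "proj_equivalent S T \<longleftrightarrow> (\<exists>f. collineation f \<and> f ` S = T)"

end

theory Submission
  imports Defs "HOL-Number_Theory.Residues"
begin

text \<open>
  A Redei set \<open>T\<close> of size $13 = 7 + 6$ has at most six points on every line, and by minimality a
  tangent line at each of its points (\<open>minimal_blocking_set_iff_tangents\<close>). As its index is 3, it lies
  on three lines, and in suitable homogeneous coordinates these lines are $x = 0$, $y = 0$ and
  either $x + y = 0$ or $z = 0$ (\<open>three_lines_frame\<close>).

  Three concurrent lines are excluded by the Cauchy--Davenport theorem
  (\<open>concurrent_impossible\<close>). Removing the common point, which has to belong to \<open>T\<close>, leaves an affine
  line of seven points on each of the three lines. If $A, B, C \subseteq F_7$ describe the points not in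
  \<open>T\<close>, blocking means that $B - A$ misses \<open>C\<close>, so $|A| + |B| - 1 \le 7 - |C|$; but counting gives
  $|A| + |B| + |C| = 9$.

  For the sides of a triangle, the three vertices belong to \<open>T\<close>. Let $A, B, C \subseteq F_7^*$ now
  describe the points of the sides that are not in \<open>T\<close>. By Menelaus, blocking says that $abc = 1$ has
  no solution in $A \times B \times C$, and the tangents say that no element can be added to one of
  these sets (\<open>gap_product\<close>, \<open>gap_maximal\<close>). The sets have at least two elements, and eight in total, so
  up to rotation the sizes are (2, 2, 4) or (2, 3, 3). In the second case \<open>B\<close> is a coset of the
  subgroup of order 3, and then \<open>A\<close> could be enlarged to such a coset
  (\<open>product_avoiding_2_3_3\<close>). In the first case \<open>A\<close> and \<open>B\<close> are cosets of $\{1, -1\}$ and determine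
  \<open>C\<close> (\<open>product_avoiding_2_2_4\<close>). Rescaling the coordinate vectors gives $A = B = \{1, -1\}$,
  which is one explicit set, \<open>tri_set\<close>. It remains to check that this set has all the required
  properties.
\<close>

section \<open>Homogeneous coordinates\<close>

text \<open>
  A projective frame: three linearly independent vectors, written so that the notion is visibly
  invariant under rotation of the vectors. Every argument about one vertex or side of a triangle
  applies to the others by rotating the frame.
\<close>

definition frame :: "'a::{field,finite} ^ 3 \<Rightarrow> 'a ^ 3 \<Rightarrow> 'a ^ 3 \<Rightarrow> bool" where
  "frame u v w \<longleftrightarrow> (\<forall>x y z. x *s u + y *s v + z *s w = 0 \<longrightarrow> x = 0 \<and> y = 0 \<and> z = 0)"

text \<open>
  The point with homogeneous coordinates $(x : y : z)$ with respect to a frame. It is a point of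
  the plane only if the coordinates are not all 0.
\<close>

definition hpt :: "'a::{field,finite} ^ 3 \<Rightarrow> 'a ^ 3 \<Rightarrow> 'a ^ 3 \<Rightarrow> 'a \<Rightarrow> 'a \<Rightarrow> 'a \<Rightarrow> ('a ^ 3) set" where
  "hpt u v w x y z = vec.span {x *s u + y *s v + z *s w}"

text \<open>
  The line $a x + b y + c z = 0$ with respect to a frame.
\<close>

definition hline :: "'a::{field,finite} ^ 3 \<Rightarrow> 'a ^ 3 \<Rightarrow> 'a ^ 3 \<Rightarrow> 'a \<Rightarrow> 'a \<Rightarrow> 'a \<Rightarrow> ('a ^ 3) set set" where
  "hline u v w a b c =
     {hpt u v w x y z | x y z. (x \<noteq> 0 \<or> y \<noteq> 0 \<or> z \<noteq> 0) \<and> a * x + b * y + c * z = 0}"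

text \<open>
  The standard bilinear form. The planes through 0 are the kernels of the functionals
  \<open>dot n\<close> with \<open>n\<close> nonzero.
\<close>

definition dot :: "'a::{field,finite} ^ 3 \<Rightarrow> 'a ^ 3 \<Rightarrow> 'a" where
  "dot n p = (\<Sum>i\<in>UNIV. n $ i * p $ i)"

lemma dot_commute: "dot n p = dot p n"
  by (simp add: dot_def mult.commute)

lemma dot_linear [simp]:
  "dot n 0 = 0" "dot n (p + q) = dot n p + dot n q" "dot n (c *s p) = c * dot n p"
  "dot 0 p = 0" "dot (m + n) p = dot m p + dot n p" "dot (c *s n) p = c * dot n p"
  by (simp_all add: dot_def sum_3 algebra_simps)

lemma frame_rotate: "frame u v w \<Longrightarrow> frame v w u"
proof -
  assume f: "frame u v w"
  show "frame v w u" unfolding frame_def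
  proof (intro allI impI)
    fix y z x assume "y *s v + z *s w + x *s u = 0"
    then have "x *s u + y *s v + z *s w = 0" by (simp only: ac_simps)
    then show "y = 0 \<and> z = 0 \<and> x = 0" using f unfolding frame_def by blast
  qed
qed

lemma frame_unique:
  assumes "frame u v w" "x *s u + y *s v + z *s w = x' *s u + y' *s v + z' *s w"
  shows "x = x' \<and> y = y' \<and> z = z'"
proof -
  have "(x - x') *s u + (y - y') *s v + (z - z') *s w = 0"
    using assms(2) by (simp add: vec.scale_left_diff_distrib algebra_simps)
  then show ?thesis using assms(1) unfolding frame_def by (metis right_minus_eq)
qed

text \<open>
  The matrix with columns \<open>u\<close>, \<open>v\<close>, \<open>w\<close>.
\<close>

definition frame_matrix :: "'a::{field,finite} ^ 3 \<Rightarrow> 'a ^ 3 \<Rightarrow> 'a ^ 3 \<Rightarrow> 'a ^ 3 ^ 3" where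
  "frame_matrix u v w = transpose (vector [u, v, w])"

lemma frame_matrix_mult:
  "frame_matrix u v w *v p = p $ 1 *s u + p $ 2 *s v + p $ 3 *s w"
  unfolding vec_eq_iff forall_3
  by (simp add: matrix_vector_mult_def frame_matrix_def transpose_def sum_3 mult.commute)

lemma frame_invertible:
  assumes "frame u v w" shows "invertible (frame_matrix u v w)"
proof -
  have "p = 0" if "frame_matrix u v w *v p = 0" for p
  proof -
    have "p $ 1 = 0 \<and> p $ 2 = 0 \<and> p $ 3 = 0"
      using that assms unfolding frame_matrix_mult frame_def by blast
    then show ?thesis by (simp add: vec_eq_iff forall_3)
  qed
  then show ?thesis unfolding invertible_left_inverse matrix_left_invertible_ker by blast
qed

lemma frame_spans:
  assumes "frame u v w"
  obtains x y z where "p = x *s u + y *s v + z *s w"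
proof -
  obtain B where "frame_matrix u v w ** B = mat 1"
    using frame_invertible[OF assms] unfolding invertible_def by blast
  then have "frame_matrix u v w *v (B *v p) = p"
    by (metis matrix_vector_mul_assoc matrix_vector_mul_lid)
  then show thesis using that unfolding frame_matrix_mult by metis
qed

text \<open>
  Linear functionals take prescribed values on a frame.
\<close>

lemma frame_dual:
  assumes "frame u v w"
  obtains n where "dot n u = a" "dot n v = b" "dot n w = c"
proof -
  let ?M = "vector [u, v, w] :: 'a ^ 3 ^ 3"
  have "\<exists>B. B ** transpose ?M = mat 1"
    using frame_invertible[OF assms] unfolding frame_matrix_def invertible_def by blast
  then obtain B where "?M ** B = mat 1" unfolding left_invertible_transpose by blast
  then have *: "?M *v (B *v vector [a, b, c]) = vector [a, b, c]"
    by (metis matrix_vector_mul_assoc matrix_vector_mul_lid)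
  define n where "n = B *v vector [a, b, c]"
  have "?M *v n = vector [dot n u, dot n v, dot n w]"
    by (simp add: vec_eq_iff forall_3 matrix_vector_mult_def dot_def mult.commute)
  with * have "vector [dot n u, dot n v, dot n w] = (vector [a, b, c] :: 'a ^ 3)"
    by (simp add: n_def)
  then have "dot n u = a" "dot n v = b" "dot n w = c"
    by (metis vector_3)+
  then show thesis using that by blast
qed

lemma frame_axis: "frame (axis 1 1) (axis 2 1) (axis 3 1 :: 'a::{field,finite} ^ 3)"
  by (simp add: frame_def vec_eq_iff forall_3 axis_def)

lemma frame_dual_zero:
  assumes "frame u v w" "dot n u = 0" "dot n v = 0" "dot n w = 0" shows "n = 0"
proof (rule ccontr)
  assume "n \<noteq> 0"
  then obtain i where i: "n $ i \<noteq> 0" by (auto simp: vec_eq_iff)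
  obtain x y z where "axis i 1 = x *s u + y *s v + z *s w" using frame_spans[OF assms(1)] .
  then have "dot n (axis i 1) = 0" using assms by simp
  moreover have "dot n (axis i 1) = n $ i" by (simp add: dot_def axis_def if_distrib cong: if_cong)
  ultimately show False using i by simp
qed

lemma frame_extend:
  assumes "vec.independent {p, q}" "p \<noteq> q"
  obtains r where "frame p q r"
proof -
  have "card {p,q} = 2" using assms by simp
  then have "vec.dim (vec.span {p, q}) = 2"
    using vec.dim_span_eq_card_independent[OF assms(1)] by simp
  moreover have "vec.dim (UNIV :: ('a ^ 3) set) = 3" by (simp add: vec.dimension_def card_cart_basis)
  ultimately obtain r where r: "r \<notin> vec.span {p, q}"
    by (metis UNIV_eq_I numeral_eq_iff num.distinct(5) eval_nat_numeral(2))
  have "frame p q r" unfolding frame_def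
  proof (intro allI impI)
    fix x y z assume e: "x *s p + y *s q + z *s r = 0"
    have z: "z = 0"
    proof (rule ccontr)
      assume nz: "z \<noteq> 0"
      have "z *s r = - (x *s p + y *s q)" using e by (metis add.inverse_unique)
      then have "z *s r = (- x) *s p + (- y) *s q" by simp
      moreover have "(- x) *s p + (- y) *s q \<in> vec.span {p,q}"
        by (intro vec.span_add vec.span_scale vec.span_base) auto
      ultimately have "inverse z *s (z *s r) \<in> vec.span {p,q}" using vec.span_scale by metis
      then show False using r nz by simp
    qed
    have y: "y = 0"
    proof (rule ccontr)
      assume "y \<noteq> 0"
      have "x *s p + y *s q = 0" using e z by simp
      then have "y *s q = (- x) *s p" by (metis add.inverse_unique vec.scale_minus_left)
      then have "inverse y *s (y *s q) = (inverse y * - x) *s p" by simp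
      then have "q = (inverse y * - x) *s p" using \<open>y \<noteq> 0\<close> by simp
      then have "q \<in> vec.span {p}" unfolding vec.span_singleton by (rule range_eqI)
      moreover have "vec.independent (insert q {p})" using assms(1) by (simp add: insert_commute)
      ultimately show False using assms(2) by (simp add: vec.independent_insert)
    qed
    have "p \<noteq> 0" using assms(1) vec.dependent_zero by blast
    then have "x = 0" using e z y by simp
    then show "x = 0 \<and> y = 0 \<and> z = 0" using y z by simp
  qed
  then show thesis using that by blast
qed

lemma pg_points_iff: "P \<in> pg_points \<longleftrightarrow> (\<exists>p. p \<noteq> 0 \<and> P = vec.span {p})"
proof
  assume "P \<in> pg_points"
  then have P: "vec.subspace P" "vec.dim P = 1" unfolding pg_points_def by auto
  obtain B where B: "B \<subseteq> P" "vec.independent B" "P \<subseteq> vec.span B" "card B = vec.dim P"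
    using vec.basis_exists by blast
  then obtain p where p: "B = {p}" using P by (metis card_1_singletonE)
  have "P = vec.span {p}" using B P p by (simp add: vec.span_minimal subset_antisym)
  moreover have "p \<noteq> 0" using B p vec.dependent_zero by blast
  ultimately show "\<exists>p. p \<noteq> 0 \<and> P = vec.span {p}" by blast
next
  assume "\<exists>p. p \<noteq> 0 \<and> P = vec.span {p}"
  then show "P \<in> pg_points" unfolding pg_points_def by auto
qed

lemma frame_not_zero:
  assumes "frame u v w" "x \<noteq> 0 \<or> y \<noteq> 0 \<or> z \<noteq> 0"
  shows "x *s u + y *s v + z *s w \<noteq> 0"
  using assms unfolding frame_def by blast

lemma hpt_rotate: "hpt v w u y z x = hpt u v w x y z"
  by (simp add: hpt_def add.commute add.left_commute)

lemma hpt_in_points: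
  assumes "frame u v w" "x \<noteq> 0 \<or> y \<noteq> 0 \<or> z \<noteq> 0"
  shows "hpt u v w x y z \<in> pg_points"
  unfolding pg_points_iff hpt_def
  using frame_not_zero[OF assms] by (intro exI[of _ "x *s u + y *s v + z *s w"]) simp

lemma pg_points_hpt:
  assumes "frame u v w" "P \<in> pg_points"
  obtains x y z where "x \<noteq> 0 \<or> y \<noteq> 0 \<or> z \<noteq> 0" "P = hpt u v w x y z"
proof -
  obtain p where p: "p \<noteq> 0" "P = vec.span {p}" using assms pg_points_iff by blast
  obtain x y z where e: "p = x *s u + y *s v + z *s w" using frame_spans[OF assms(1)] .
  then have "x \<noteq> 0 \<or> y \<noteq> 0 \<or> z \<noteq> 0" using p by auto
  then show thesis using that p e unfolding hpt_def by blast
qed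

lemma span_scale_singleton:
  assumes "c \<noteq> (0::'a::field)" shows "vec.span {c *s p} = vec.span {p :: 'a ^ 'n}"
proof (rule subset_antisym)
  show "vec.span {c *s p} \<subseteq> vec.span {p}"
    by (intro vec.span_minimal) (simp_all add: vec.span_scale vec.span_base)
  have "inverse c *s (c *s p) \<in> vec.span {c *s p}" by (intro vec.span_scale vec.span_base) simp
  then show "vec.span {p} \<subseteq> vec.span {c *s p}"
    using assms by (intro vec.span_minimal) simp_all
qed

lemma hpt_scale:
  assumes "c \<noteq> 0" shows "hpt u v w (c * x) (c * y) (c * z) = hpt u v w x y z"
  using span_scale_singleton[OF assms, of "x *s u + y *s v + z *s w"]
  by (simp add: hpt_def)

lemma hpt_eq_iff:
  assumes "frame u v w" "x \<noteq> 0 \<or> y \<noteq> 0 \<or> z \<noteq> 0"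
  shows "hpt u v w x y z = hpt u v w x' y' z' \<longleftrightarrow>
    (\<exists>c. c \<noteq> 0 \<and> x = c * x' \<and> y = c * y' \<and> z = c * z')"
proof
  assume "hpt u v w x y z = hpt u v w x' y' z'"
  then have "x *s u + y *s v + z *s w \<in> vec.span {x' *s u + y' *s v + z' *s w}"
    unfolding hpt_def using vec.span_base by blast
  then obtain c where "x *s u + y *s v + z *s w = c *s (x' *s u + y' *s v + z' *s w)"
    by (auto simp: vec.span_singleton)
  then have "x *s u + y *s v + z *s w = (c * x') *s u + (c * y') *s v + (c * z') *s w"
    by (simp add: vector_add_ldistrib)
  from frame_unique[OF assms(1) this] show "\<exists>c. c \<noteq> 0 \<and> x = c * x' \<and> y = c * y' \<and> z = c * z'"
    using assms(2) by auto
next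
  assume "\<exists>c. c \<noteq> 0 \<and> x = c * x' \<and> y = c * y' \<and> z = c * z'"
  then show "hpt u v w x y z = hpt u v w x' y' z'" using hpt_scale by metis
qed

lemma hpt_in_hline:
  "x \<noteq> 0 \<or> y \<noteq> 0 \<or> z \<noteq> 0 \<Longrightarrow> a * x + b * y + c * z = 0 \<Longrightarrow>
    hpt u v w x y z \<in> hline u v w a b c"
  unfolding hline_def by blast

lemma hpt_in_hline_iff:
  assumes "frame u v w" "x \<noteq> 0 \<or> y \<noteq> 0 \<or> z \<noteq> 0"
  shows "hpt u v w x y z \<in> hline u v w a b c \<longleftrightarrow> a * x + b * y + c * z = 0"
proof
  assume "hpt u v w x y z \<in> hline u v w a b c"
  then obtain x' y' z' where *: "hpt u v w x y z = hpt u v w x' y' z'" "a * x' + b * y' + c * z' = 0"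
    unfolding hline_def by blast
  from * obtain k where "x = k * x'" "y = k * y'" "z = k * z'" using hpt_eq_iff[OF assms] by blast
  then have "a * x + b * y + c * z = k * (a * x' + b * y' + c * z')" by (simp add: algebra_simps)
  then show "a * x + b * y + c * z = 0" using * by simp
next
  assume "a * x + b * y + c * z = 0"
  then show "hpt u v w x y z \<in> hline u v w a b c" using assms(2) by (intro hpt_in_hline)
qed

lemma kernel_subspace: "vec.subspace {p. dot n p = 0}"
  by (simp add: vec.subspace_def)

lemma dim_space: "vec.dim (UNIV :: ('a::field ^ 3) set) = 3"
  by (simp add: vec.dimension_def card_cart_basis)

lemma kernel_dim:
  assumes "n \<noteq> 0" shows "vec.dim {p. dot n p = 0} = 2"
proof -
  let ?K = "{p. dot n p = 0}"
  obtain m where m: "dot n m \<noteq> 0"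
    using frame_dual_zero[OF frame_axis, of n] assms by blast
  then have mK: "m \<notin> vec.span ?K" by (simp add: kernel_subspace[THEN vec.span_eq_iff[THEN iffD2]])
  have "p \<in> vec.span (insert m ?K)" for p
  proof -
    have "p - (dot n p / dot n m) *s m \<in> ?K"
    proof -
      have "dot n p = dot n (p - (dot n p / dot n m) *s m + (dot n p / dot n m) *s m)" by simp
      also have "\<dots> = dot n (p - (dot n p / dot n m) *s m) + dot n p" using m by (subst dot_linear) simp
      finally show ?thesis by simp
    qed
    then have "p - (dot n p / dot n m) *s m \<in> vec.span ?K" by (rule vec.span_base)
    then show ?thesis unfolding vec.span_breakdown_eq by (rule exI)
  qed
  then have "vec.span (insert m ?K) = UNIV" by (rule UNIV_eq_I[symmetric])
  then have "vec.dim (insert m ?K) = 3" using dim_space vec.dim_span by metis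
  then show ?thesis using mK by (simp add: vec.dim_insert)
qed

lemma plane_kernel:
  assumes "vec.subspace W" "vec.dim W = 2"
  obtains n where "n \<noteq> 0" "W = {p. dot n p = 0}"
proof -
  obtain B where B: "B \<subseteq> W" "vec.independent B" "W \<subseteq> vec.span B" "card B = vec.dim W"
    using vec.basis_exists by blast
  then obtain p q where pq: "B = {p, q}" "p \<noteq> q" using assms by (metis card_2_iff)
  obtain r where fr: "frame p q r" using frame_extend B pq by metis
  obtain n where n: "dot n p = 0" "dot n q = 0" "dot n r = 1" using frame_dual[OF fr] .
  have n0: "n \<noteq> 0" using n by auto
  have "vec.span B \<subseteq> {p. dot n p = 0}"
    by (rule vec.span_minimal) (use n pq kernel_subspace in auto)
  then have "W \<subseteq> {p. dot n p = 0}" using B by blast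
  then have "W = {p. dot n p = 0}"
    using vec.subspace_dim_equal[OF assms(1) kernel_subspace] kernel_dim[OF n0] assms by simp
  then show thesis using that n0 by blast
qed

lemma kernel_line_eq_hline:
  assumes "frame u v w"
  shows "{P \<in> pg_points. P \<subseteq> {p. dot n p = 0}} = hline u v w (dot n u) (dot n v) (dot n w)"
proof -
  have sub: "hpt u v w x y z \<subseteq> {p. dot n p = 0} \<longleftrightarrow> dot n u * x + dot n v * y + dot n w * z = 0" for x y z
  proof -
    let ?p = "x *s u + y *s v + z *s w"
    have "vec.span {?p} \<subseteq> {p. dot n p = 0} \<longleftrightarrow> dot n ?p = 0"
    proof
      assume "vec.span {?p} \<subseteq> {p. dot n p = 0}"
      then show "dot n ?p = 0" using vec.span_base[of ?p "{?p}"] by blast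
    next
      assume "dot n ?p = 0"
      then show "vec.span {?p} \<subseteq> {p. dot n p = 0}"
        by (intro vec.span_minimal kernel_subspace) simp
    qed
    then show ?thesis unfolding hpt_def by (simp add: mult.commute)
  qed
  show ?thesis
  proof (intro Set.set_eqI iffI)
    fix P assume "P \<in> {P \<in> pg_points. P \<subseteq> {p. dot n p = 0}}"
    then have P: "P \<in> pg_points" "P \<subseteq> {p. dot n p = 0}" by auto
    obtain x y z where xyz: "x \<noteq> 0 \<or> y \<noteq> 0 \<or> z \<noteq> 0" "P = hpt u v w x y z"
      using pg_points_hpt[OF assms P(1)] .
    then have "dot n u * x + dot n v * y + dot n w * z = 0" using P(2) sub by simp
    then show "P \<in> hline u v w (dot n u) (dot n v) (dot n w)"
      unfolding xyz(2) using hpt_in_hline_iff[OF assms xyz(1)] by simp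
  next
    fix P assume "P \<in> hline u v w (dot n u) (dot n v) (dot n w)"
    then obtain x y z where "P = hpt u v w x y z" "x \<noteq> 0 \<or> y \<noteq> 0 \<or> z \<noteq> 0"
      "dot n u * x + dot n v * y + dot n w * z = 0" unfolding hline_def by blast
    then show "P \<in> {P \<in> pg_points. P \<subseteq> {p. dot n p = 0}}"
      using sub hpt_in_points[OF assms] by simp
  qed
qed

lemma pg_line_is_hline:
  assumes "frame u v w" "l \<in> pg_lines"
  obtains a b c where "a \<noteq> 0 \<or> b \<noteq> 0 \<or> c \<noteq> 0" "l = hline u v w a b c"
proof -
  from assms(2) have "\<exists>W. l = {P \<in> pg_points. P \<subseteq> W} \<and> vec.subspace W \<and> vec.dim W = 2"
    by (simp only: pg_lines_def mem_Collect_eq)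
  then obtain W where W': "l = {P \<in> pg_points. P \<subseteq> W} \<and> vec.subspace W \<and> vec.dim W = 2" ..
  note W = W'[THEN conjunct1] W'[THEN conjunct2, THEN conjunct1] W'[THEN conjunct2, THEN conjunct2]
  obtain n where n: "n \<noteq> 0" "W = {p. dot n p = 0}" using plane_kernel[OF W(2,3)] .
  have "dot n u \<noteq> 0 \<or> dot n v \<noteq> 0 \<or> dot n w \<noteq> 0" using frame_dual_zero[OF assms(1)] n(1) by blast
  moreover have "l = hline u v w (dot n u) (dot n v) (dot n w)"
    unfolding W(1) n(2) by (rule kernel_line_eq_hline[OF assms(1)])
  ultimately show thesis by (rule that)
qed

lemma hline_in_lines:
  assumes "frame u v w" "a \<noteq> 0 \<or> b \<noteq> 0 \<or> c \<noteq> 0"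
  shows "hline u v w a b c \<in> pg_lines"
proof -
  obtain n where n: "dot n u = a" "dot n v = b" "dot n w = c" using frame_dual[OF assms(1)] .
  then have "n \<noteq> 0" using assms(2) by auto
  have "hline u v w a b c = {P \<in> pg_points. P \<subseteq> {p. dot n p = 0}}"
    using kernel_line_eq_hline[OF assms(1), of n] n by simp
  then show ?thesis
    using kernel_subspace[of n] kernel_dim[OF \<open>n \<noteq> 0\<close>] unfolding pg_lines_def mem_Collect_eq
    by (intro exI[of _ "{p. dot n p = 0}"] conjI)
qed

lemma frame_change_collineation:
  assumes "frame u v w"
  obtains f where "collineation f"
    "\<And>x y z. f (hpt (axis 1 1) (axis 2 1) (axis 3 1) x y z) = hpt u v w x y z"
proof -
  let ?e = "hpt (axis 1 1) (axis 2 1) (axis 3 1 :: 'a ^ 3)"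
  let ?M = "frame_matrix u v w"
  define f where "f = (`) ((*v) ?M)"
  have f: "f (?e x y z) = hpt u v w x y z" for x y z
  proof -
    let ?p = "x *s axis 1 1 + y *s axis 2 1 + z *s axis 3 1 :: 'a ^ 3"
    have *: "?M *v ?p = x *s u + y *s v + z *s w"
      unfolding frame_matrix_mult vector_add_component vector_smult_component by (simp add: axis_def)
    have "f (vec.span {p}) = vec.span {?M *v p}" for p
      unfolding f_def vec.span_singleton image_image vector_scalar_commute ..
    then show ?thesis unfolding hpt_def *[symmetric] .
  qed
  have inj: "inj_on f pg_points"
  proof (rule inj_onI)
    fix P Q assume PQ: "P \<in> pg_points" "Q \<in> pg_points" "f P = f Q"
    obtain x y z where P: "x \<noteq> 0 \<or> y \<noteq> 0 \<or> z \<noteq> 0" "P = ?e x y z" using pg_points_hpt[OF frame_axis PQ(1)] .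
    obtain x' y' z' where Q: "x' \<noteq> 0 \<or> y' \<noteq> 0 \<or> z' \<noteq> 0" "Q = ?e x' y' z'"
      using pg_points_hpt[OF frame_axis PQ(2)] .
    show "P = Q"
      using PQ(3) unfolding P(2) Q(2) f hpt_eq_iff[OF assms P(1)] hpt_eq_iff[OF frame_axis P(1)] .
  qed
  have img: "f ` pg_points = pg_points"
  proof (intro Set.set_eqI iffI)
    fix P assume "P \<in> f ` pg_points"
    then obtain Q where Q: "Q \<in> pg_points" "P = f Q" by blast
    obtain x y z where q: "x \<noteq> 0 \<or> y \<noteq> 0 \<or> z \<noteq> 0" "Q = ?e x y z"
      using pg_points_hpt[OF frame_axis Q(1)] .
    then show "P \<in> pg_points" using hpt_in_points[OF assms q(1)] Q(2) f by simp
  next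
    fix P :: "('a ^ 3) set" assume "P \<in> pg_points"
    then obtain x y z where xyz: "x \<noteq> 0 \<or> y \<noteq> 0 \<or> z \<noteq> 0" "P = hpt u v w x y z"
      by (rule pg_points_hpt[OF assms])
    then show "P \<in> f ` pg_points"
      using f by (intro image_eqI[OF _ hpt_in_points[OF frame_axis xyz(1)]]) simp
  qed
  have lin: "f ` hline (axis 1 1) (axis 2 1) (axis 3 1) a b c = hline u v w a b c" for a b c
  proof
    show "f ` hline (axis 1 1) (axis 2 1) (axis 3 1) a b c \<subseteq> hline u v w a b c"
    proof
      fix P assume "P \<in> f ` hline (axis 1 1) (axis 2 1) (axis 3 1) a b c"
      then obtain x y z where "P = f (?e x y z)" "x \<noteq> 0 \<or> y \<noteq> 0 \<or> z \<noteq> 0" "a * x + b * y + c * z = 0"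
        unfolding hline_def by blast
      then show "P \<in> hline u v w a b c" using hpt_in_hline_iff[OF assms] by (simp add: f)
    qed
    show "hline u v w a b c \<subseteq> f ` hline (axis 1 1) (axis 2 1) (axis 3 1) a b c"
    proof
      fix P assume "P \<in> hline u v w a b c"
      then obtain x y z where "P = hpt u v w x y z" "x \<noteq> 0 \<or> y \<noteq> 0 \<or> z \<noteq> 0" "a * x + b * y + c * z = 0"
        unfolding hline_def by blast
      then show "P \<in> f ` hline (axis 1 1) (axis 2 1) (axis 3 1) a b c"
        by (intro image_eqI[of _ _ "?e x y z"]) (auto simp only: f intro: hpt_in_hline)
    qed
  qed
  have "(\<lambda>l. f ` l) ` pg_lines = pg_lines"
  proof
    show "(\<lambda>l. f ` l) ` pg_lines \<subseteq> pg_lines"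
    proof
      fix l assume "l \<in> (\<lambda>l. f ` l) ` pg_lines"
      then obtain m where m: "m \<in> pg_lines" "l = f ` m" by blast
      obtain a b c where "a \<noteq> 0 \<or> b \<noteq> 0 \<or> c \<noteq> 0" "m = hline (axis 1 1) (axis 2 1) (axis 3 1) a b c"
        using pg_line_is_hline[OF frame_axis m(1)] .
      then show "l \<in> pg_lines" using m(2) lin hline_in_lines[OF assms] by simp
    qed
    show "pg_lines \<subseteq> (\<lambda>l. f ` l) ` pg_lines"
    proof
      fix l :: "('a ^ 3) set set" assume "l \<in> pg_lines"
      then obtain a b c where abc: "a \<noteq> 0 \<or> b \<noteq> 0 \<or> c \<noteq> 0" "l = hline u v w a b c"
        by (rule pg_line_is_hline[OF assms])
      then show "l \<in> (\<lambda>l. f ` l) ` pg_lines"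
        by (intro image_eqI[OF _ hline_in_lines[OF frame_axis abc(1)]]) (simp add: lin)
    qed
  qed
  then have "collineation f" using inj img unfolding collineation_def bij_betw_def by blast
  then show thesis using that f by blast
qed

section \<open>Sums and products in a field with seven elements\<close>

lemma of_nat_eq_0_iff_prime_card:
  assumes "prime CARD('a::{field,finite})"
  shows "(of_nat n :: 'a) = 0 \<longleftrightarrow> CARD('a) dvd n"
proof -
  have "CHAR('a) dvd CARD('a)" by (rule CHAR_dvd_CARD)
  moreover have "CHAR('a) \<noteq> 1" by simp
  ultimately have "CHAR('a) = CARD('a)" using assms by (metis prime_nat_iff)
  then show ?thesis by (simp add: of_nat_eq_0_iff_char_dvd)
qed

text \<open>
  Comparing the sum of the elements of \<open>A\<close> with that of its translate shows that the order
  of the field divides $|A|$.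
\<close>

lemma translation_invariant_eq_UNIV:
  fixes A :: "'a::{field,finite} set"
  assumes "prime CARD('a)" "d \<noteq> 0" "A \<noteq> {}" "\<And>x. x \<in> A \<Longrightarrow> x + d \<in> A"
  shows "A = UNIV"
proof -
  have inj: "inj_on (\<lambda>x. x + d) A" by (simp add: inj_on_def)
  have img: "(\<lambda>x. x + d) ` A = A"
    by (rule card_subset_eq) (use assms(4) in \<open>auto simp: card_image[OF inj]\<close>)
  have "(\<Sum>x\<in>A. x) = (\<Sum>x\<in>(\<lambda>x. x + d) ` A. x)" by (simp only: img)
  also have "\<dots> = (\<Sum>x\<in>A. x + d)" using sum.reindex[OF inj] by (simp add: comp_def)
  also have "\<dots> = (\<Sum>x\<in>A. x) + of_nat (card A) * d" by (simp add: sum.distrib)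
  finally have "(of_nat (card A) :: 'a) = 0" using assms(2) by simp
  then have "CARD('a) dvd card A" using of_nat_eq_0_iff_prime_card[OF assms(1)] by simp
  moreover have "card A > 0" using assms(3) by (simp add: card_gt_0_iff)
  ultimately have "CARD('a) \<le> card A" by (simp add: dvd_imp_le)
  then show ?thesis by (intro card_seteq) auto
qed

text \<open>
  The Cauchy--Davenport theorem, for the additive group of a field of prime order. The proof is by
  induction on the size of \<open>B\<close>. If \<open>A\<close> is not everything, there is a translate of \<open>B\<close> that meets \<open>A\<close>
  without being contained in it. Points of the translate are moved into \<open>A\<close>, and only those \<open>b\<close> are
  kept in \<open>B\<close> whose translate was already in \<open>A\<close>; this preserves $|A| + |B|$ and does not enlarge
  the sumset.
\<close>

lemma cauchy_davenport:
  fixes A B :: "'a::{field,finite} set"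
  assumes p: "prime CARD('a)" and "A \<noteq> {}" "B \<noteq> {}"
  shows "min CARD('a) (card A + card B - 1) \<le> card {a + b | a b. a \<in> A \<and> b \<in> B}"
  using assms(2,3)
proof (induction "card B" arbitrary: A B rule: less_induct)
  case less
  let ?S = "\<lambda>A B. {a + b | a b. a \<in> A \<and> b \<in> B}"
  show ?case
  proof (cases "\<exists>b. B = {b}")
    case True
    then obtain b where B: "B = {b}" by blast
    have "?S A B = (\<lambda>a. a + b) ` A" using B by auto
    then have "card (?S A B) = card A" by (simp add: card_image)
    then show ?thesis using B by simp
  next
    case False
    obtain b1 b2 where b: "b1 \<in> B" "b2 \<in> B" "b1 \<noteq> b2" using False less.prems(2) by blast
    show ?thesis
    proof (cases "A = UNIV")
      case True
      have "x \<in> ?S A B" for x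
      proof -
        have "x = (x - b1) + b1" by simp
        then show ?thesis using b(1) True by blast
      qed
      then have "?S A B = UNIV" by blast
      then show ?thesis by simp
    next
      case False
      have "\<exists>a\<in>A. a + (b2 - b1) \<notin> A"
        using translation_invariant_eq_UNIV[OF p, of "b2 - b1" A] b(3) less.prems(1) False by auto
      then obtain a where a: "a \<in> A" "a + (b2 - b1) \<notin> A" by blast
      define t where "t = a - b1"
      define B' where "B' = {b \<in> B. b + t \<in> A}"
      define A' where "A' = A \<union> (\<lambda>b. b + t) ` B"
      have b': "b1 \<in> B'" "b2 \<notin> B'" using a b by (auto simp: B'_def t_def algebra_simps)
      have lt: "card B' < card B" by (rule psubset_card_mono) (use b b' B'_def in auto)
      have "A' = A \<union> (\<lambda>b. b + t) ` (B - B')" by (auto simp: A'_def B'_def)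
      moreover have "A \<inter> (\<lambda>b. b + t) ` (B - B') = {}" by (auto simp: B'_def)
      moreover have "card ((\<lambda>b. b + t) ` (B - B')) = card B - card B'"
        by (simp add: card_image card_Diff_subset B'_def)
      ultimately have "card A' = card A + (card B - card B')" by (simp add: card_Un_disjoint)
      then have "card A' + card B' = card A + card B" using lt by simp
      moreover have "min CARD('a) (card A' + card B' - 1) \<le> card (?S A' B')"
        by (rule less.hyps[OF lt]) (use b' less.prems A'_def in auto)
      moreover have "card (?S A' B') \<le> card (?S A B)"
      proof (rule card_mono)
        show "?S A' B' \<subseteq> ?S A B"
        proof
          fix s assume "s \<in> ?S A' B'"
          then obtain x y where s: "s = x + y" "x \<in> A'" "y \<in> B'" by blast
          show "s \<in> ?S A B"
          proof (cases "x \<in> A")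
            case True
            then show ?thesis using s B'_def by blast
          next
            case False
            then obtain z where "z \<in> B" "x = z + t" using s A'_def by blast
            then have "s = (y + t) + z" "y + t \<in> A" "z \<in> B" using s B'_def by auto
            then show ?thesis by blast
          qed
        qed
      qed simp
      ultimately show ?thesis by simp
    qed
  qed
qed

lemma field_7_facts:
  assumes "CARD('a::{field,finite}) = 7"
  shows "prime CARD('a)" "(2::'a) \<noteq> 0" "(3::'a) \<noteq> 0"
proof -
  show p: "prime CARD('a)" unfolding assms by simp
  show "(2::'a) \<noteq> 0" "(3::'a) \<noteq> 0"
    using of_nat_eq_0_iff_prime_card[OF p, of 2] of_nat_eq_0_iff_prime_card[OF p, of 3] assms by simp_all
qed

text \<open>
  The set counted here is the set of all nonzero \<open>d\<close> with $d c \ne 1$ for all $c \in C$. It contains the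
  product set of sets \<open>A\<close> and \<open>B\<close> of nonzero elements whenever $abc = 1$ has no solution in $A \times B \times C$.
\<close>

lemma card_noninverses:
  fixes C :: "'a::{field,finite} set"
  assumes "CARD('a) = 7" "0 \<notin> C"
  shows "card {d. d \<noteq> 0 \<and> inverse d \<notin> C} = 6 - card C"
proof -
  have inj: "inj_on inverse C" by (simp add: inj_on_def)
  have "{d. d \<noteq> 0 \<and> inverse d \<notin> C} = UNIV - insert 0 (inverse ` C)"
    by (auto simp: image_iff) (metis inverse_inverse_eq)
  moreover have "card (insert 0 (inverse ` C)) = Suc (card C)"
    using assms(2) by (subst card_insert_disjoint) (auto simp: card_image[OF inj])
  ultimately show ?thesis using assms(1) by (simp add: card_Diff_subset)
qed

text \<open>
  The product set of \<open>A\<close> and \<open>B\<close> has room for two elements only, so with $A = \{a, a'\}$ and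
  $B = \{b, b'\}$ one gets $a b' = a' b$ and $a' b' = a b$.
\<close>

lemma product_avoiding_2_2_4:
  fixes A B C :: "'a::{field,finite} set"
  assumes q: "CARD('a) = 7" and nz: "0 \<notin> A" "0 \<notin> B" "0 \<notin> C"
    and free: "\<And>a b c. a \<in> A \<Longrightarrow> b \<in> B \<Longrightarrow> c \<in> C \<Longrightarrow> a * b * c \<noteq> 1"
    and card: "card A = 2" "card B = 2" "card C = 4"
  obtains a b where "a \<noteq> 0" "b \<noteq> 0" "A = {a, - a}" "B = {b, - b}"
    "C = {c. c \<noteq> 0 \<and> (a * b * c)\<^sup>2 \<noteq> 1}"
proof -
  define E where "E = {d. d \<noteq> 0 \<and> inverse d \<notin> C}"
  have cE: "card E = 2" using card_noninverses[OF q nz(3)] card E_def by simp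
  have E: "x * y \<in> E" if "x \<in> A" "y \<in> B" for x y
  proof -
    have "x * y \<noteq> 0" using nz that by auto
    moreover from this have "x * y * inverse (x * y) = 1" by (rule right_inverse)
    ultimately show ?thesis using free[OF that] unfolding E_def by blast
  qed
  obtain a a' where A: "A = {a, a'}" "a \<noteq> a'" using card(1) by (metis card_2_iff)
  obtain b b' where B: "B = {b, b'}" "b \<noteq> b'" using card(2) by (metis card_2_iff)
  have n: "a \<noteq> 0" "a' \<noteq> 0" "b \<noteq> 0" "b' \<noteq> 0" using nz A B by auto
  have Eeq: "E = {a * b, a' * b}"
    by (rule card_subset_eq[symmetric]) (use E A B cE n in auto)
  have "a * b' \<in> E" "a' * b' \<in> E" using E A B by auto
  then have e: "a * b' = a' * b" "a' * b' = a * b" using Eeq n B by auto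
  have "a * b' * b' = a * b * b" using e by (metis mult.assoc mult.commute)
  then have "b' * b' = b * b" using n by (simp add: mult.assoc)
  then have b': "b' = - b" using B(2) square_eq_iff by metis
  then have a': "a' = - a" using e(1) n by (metis minus_mult_commute mult_right_cancel)
  have "c \<in> C \<longleftrightarrow> c \<noteq> 0 \<and> (a * b * c)\<^sup>2 \<noteq> 1" for c
  proof (cases "c = 0")
    case True then show ?thesis using nz by simp
  next
    case False
    have "c \<in> C \<longleftrightarrow> inverse c \<notin> E" using False by (simp add: E_def)
    also have "\<dots> \<longleftrightarrow> a * b \<noteq> inverse c \<and> - (a * b) \<noteq> inverse c" using Eeq a' by auto
    also have "\<dots> \<longleftrightarrow> a * b * c \<noteq> 1 \<and> - (a * b) * c \<noteq> 1"
      using False by (metis inverse_unique mult.commute right_inverse nonzero_imp_inverse_nonzero inverse_inverse_eq)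
    also have "\<dots> \<longleftrightarrow> (a * b * c)\<^sup>2 \<noteq> 1"
      by (auto simp: power2_eq_1_iff) (metis minus_minus)+
    finally show ?thesis using False by simp
  qed
  then have "C = {c. c \<noteq> 0 \<and> (a * b * c)\<^sup>2 \<noteq> 1}" by blast
  then show thesis using that n A B a' b' by blast
qed

text \<open>
  Here $x B = E$ for every $x \in A = \{a, a'\}$, where \<open>E\<close> is the set of elements whose inverse is not in
  \<open>C\<close>. Hence \<open>B\<close> is invariant under $r = a' / a$, and by maximality $r a' \in A$, which forces
  $r = -1$. But a set of three nonzero elements is not invariant under negation.
\<close>

lemma product_avoiding_2_3_3:
  fixes A B C :: "'a::{field,finite} set"
  assumes q: "CARD('a) = 7" and nz: "0 \<notin> A" "0 \<notin> B" "0 \<notin> C"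
    and free: "\<And>a b c. a \<in> A \<Longrightarrow> b \<in> B \<Longrightarrow> c \<in> C \<Longrightarrow> a * b * c \<noteq> 1"
    and maximal: "\<And>a. a \<noteq> 0 \<Longrightarrow> a \<notin> A \<Longrightarrow> \<exists>b\<in>B. \<exists>c\<in>C. a * b * c = 1"
    and card: "card A = 2" "card B = 3" "card C = 3"
  shows False
proof -
  define E where "E = {d. d \<noteq> 0 \<and> inverse d \<notin> C}"
  have cE: "card E = 3" using card_noninverses[OF q nz(3)] card E_def by simp
  have E: "x * y \<in> E" if "x \<in> A" "y \<in> B" for x y
  proof -
    have "x * y \<noteq> 0" using nz that by auto
    moreover from this have "x * y * inverse (x * y) = 1" by (rule right_inverse)
    ultimately show ?thesis using free[OF that] unfolding E_def by blast
  qed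
  obtain a a' where A: "A = {a, a'}" "a \<noteq> a'" using card(1) by (metis card_2_iff)
  have n: "a \<noteq> 0" "a' \<noteq> 0" using nz A by auto
  have img: "(\<lambda>y. x * y) ` B = E" if "x \<in> A" for x
  proof (rule card_subset_eq)
    have "x \<noteq> 0" using that nz by auto
    then have "inj_on (\<lambda>y. x * y) B" by (simp add: inj_on_def)
    then show "card ((\<lambda>y. x * y) ` B) = card E" using cE card by (simp add: card_image)
  qed (use E that in auto)
  define r where "r = a' / a"
  have r: "r \<noteq> 0" "r * a = a'" using n by (simp_all add: r_def)
  have rE: "(\<lambda>y. r * a' * y) ` B = E"
  proof -
    have "(\<lambda>y. r * a' * y) ` B = (\<lambda>y. r * y) ` ((\<lambda>y. a' * y) ` B)" by (simp add: image_image mult.assoc)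
    also have "\<dots> = (\<lambda>y. r * y) ` ((\<lambda>y. a * y) ` B)" using img A by simp
    also have "\<dots> = (\<lambda>y. a' * y) ` B" by (simp add: image_image mult.assoc[symmetric] r)
    finally show ?thesis using img A by simp
  qed
  have "r * a' \<in> A"
  proof (rule ccontr)
    assume "r * a' \<notin> A"
    then obtain b c where bc: "b \<in> B" "c \<in> C" "r * a' * b * c = 1" using maximal[of "r * a'"] r n by auto
    have "r * a' * b \<in> E" using rE bc(1) by blast
    moreover have "inverse (r * a' * b) = c" using bc(3) by (rule inverse_unique)
    ultimately show False using bc(2) E_def by simp
  qed
  then have "r * a' = a \<or> r * a' = a'" using A by simp
  then have ra: "r * a' = a" using r n A(2) by auto
  have "a' * a' = a * a" using ra r by (metis mult.assoc mult.commute)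
  then have a': "a' = - a" using A(2) square_eq_iff by metis
  have inj: "inj_on (\<lambda>y. - y :: 'a) B" by (simp add: inj_on_def)
  have neg: "(\<lambda>y. - y) ` B = B"
  proof -
    have "(\<lambda>y. a * y) ` ((\<lambda>y. - y) ` B) = (\<lambda>y. a' * y) ` B" by (simp add: image_image a')
    also have "\<dots> = (\<lambda>y. a * y) ` B" using img A by simp
    finally show ?thesis using n by (simp add: inj_image_eq_iff inj_def)
  qed
  have "(\<Prod>y\<in>B. y) = (\<Prod>y\<in>(\<lambda>y. - y) ` B. y)" by (simp only: neg)
  also have "\<dots> = (\<Prod>y\<in>B. - y)" using prod.reindex[OF inj] by (simp add: comp_def)
  also have "\<dots> = (- 1) ^ card B * (\<Prod>y\<in>B. y)" by (simp add: prod_uminus)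
  also have "\<dots> = - (\<Prod>y\<in>B. y)" using card by simp
  finally have "2 * (\<Prod>y\<in>B. y) = 0" by simp
  moreover have "(\<Prod>y\<in>B. y) \<noteq> 0" using nz(2) by simp
  ultimately show False using field_7_facts[OF q] by simp
qed

section \<open>Triples of lines, tangents and the index\<close>

lemma hline_rotate: "hline v w u b c a = hline u v w a b c"
proof -
  have sub: "hline v w u b c a \<subseteq> hline u v w a b c" for u v w :: "'a::{field,finite} ^ 3" and a b c
  proof
    fix P assume "P \<in> hline v w u b c a"
    then obtain y z x where P: "P = hpt v w u y z x" "y \<noteq> 0 \<or> z \<noteq> 0 \<or> x \<noteq> 0" "b * y + c * z + a * x = 0"
      unfolding hline_def by blast
    have "a * x + b * y + c * z = 0" using P(3) by (simp only: ac_simps)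
    then have "hpt u v w x y z \<in> hline u v w a b c" using P(2) by (intro hpt_in_hline) auto
    then show "P \<in> hline u v w a b c" using P(1) by (simp only: hpt_rotate[of v w u y z x])
  qed
  have "hline u v w a b c \<subseteq> hline v w u b c a"
    using sub[where u = w and v = u and w = v and a = c and b = a and c = b]
      sub[where u = v and v = w and w = u and a = b and b = c and c = a] by (rule subset_trans)
  then show ?thesis by (intro subset_antisym sub)
qed

text \<open>
  The dual frame: with respect to it, \<open>m\<close>, \<open>n\<close> and \<open>p\<close> are the coordinate functionals.
\<close>

lemma dual_frame:
  assumes "frame m n p"
  obtains u v w where "frame u v w"
    "dot m u = 1" "dot m v = 0" "dot m w = 0"
    "dot n u = 0" "dot n v = 1" "dot n w = 0"
    "dot p u = 0" "dot p v = 0" "dot p w = 1"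
proof -
  obtain u where u: "dot u m = 1" "dot u n = 0" "dot u p = 0" using frame_dual[OF assms] .
  obtain v where v: "dot v m = 0" "dot v n = 1" "dot v p = 0" using frame_dual[OF assms] .
  obtain w where w: "dot w m = 0" "dot w n = 0" "dot w p = 1" using frame_dual[OF assms] .
  have "frame u v w" unfolding frame_def
  proof (intro allI impI)
    fix x y z assume e: "x *s u + y *s v + z *s w = 0"
    have "dot (x *s u + y *s v + z *s w) m = x" "dot (x *s u + y *s v + z *s w) n = y"
      "dot (x *s u + y *s v + z *s w) p = z" by (simp_all add: u v w)
    then show "x = 0 \<and> y = 0 \<and> z = 0" unfolding e by simp
  qed
  then show thesis using that u v w by (simp add: dot_commute)
qed

lemma kernel_scale: "c \<noteq> 0 \<Longrightarrow> {p. dot (c *s n) p = 0} = {p. dot n p = 0}"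
  by simp

text \<open>
  Up to coordinates, three distinct lines form a triangle or are concurrent. If the functionals
  defining them are independent, the dual frame gives a triangle. In a linear dependency all three
  coefficients are nonzero, so after rescaling one functional is the sum of the other two.
\<close>

lemma three_lines_frame:
  assumes l: "l1 \<in> pg_lines" "l2 \<in> pg_lines" "l3 \<in> pg_lines" "l1 \<noteq> l2" "l1 \<noteq> l3" "l2 \<noteq> l3"
  obtains u v w where "frame u v w" "l1 = hline u v w 1 0 0" "l2 = hline u v w 0 1 0"
    "l3 = hline u v w 0 0 1 \<or> l3 = hline u v w 1 1 0"
proof -
  define K where "K n = {P \<in> pg_points. P \<subseteq> {p. dot n p = 0}}" for n :: "'a ^ 3"
  have ex: "\<exists>n. n \<noteq> 0 \<and> l = K n" if l: "l \<in> pg_lines" for l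
  proof -
    from l have "\<exists>W. l = {P \<in> pg_points. P \<subseteq> W} \<and> vec.subspace W \<and> vec.dim W = 2"
      by (simp only: pg_lines_def mem_Collect_eq)
    then obtain W where W: "l = {P \<in> pg_points. P \<subseteq> W} \<and> vec.subspace W \<and> vec.dim W = 2" ..
    then have W': "vec.subspace W" "vec.dim W = 2" by simp_all
    obtain n where "n \<noteq> 0" "W = {p. dot n p = 0}" by (rule plane_kernel[OF W'])
    then show ?thesis using W unfolding K_def by (intro exI[of _ n]) simp
  qed
  have scale: "K (c *s n) = K n" if "c \<noteq> 0" for c n unfolding K_def kernel_scale[OF that] ..
  have Kh: "K n = hline u v w (dot n u) (dot n v) (dot n w)" if "frame u v w" for n u v w
    unfolding K_def by (rule kernel_line_eq_hline[OF that])
  obtain n1 where n1: "n1 \<noteq> 0 \<and> l1 = K n1" using ex[OF l(1)] ..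
  obtain n2 where n2: "n2 \<noteq> 0 \<and> l2 = K n2" using ex[OF l(2)] ..
  obtain n3 where n3: "n3 \<noteq> 0 \<and> l3 = K n3" using ex[OF l(3)] ..
  have depend: False if "x *s m + y *s n = 0" "m \<noteq> 0" "n \<noteq> 0" "K m \<noteq> K n" "x \<noteq> 0 \<or> y \<noteq> 0" for x y m n
  proof -
    have e: "x *s m = (- y) *s n" using that(1) by (simp add: eq_neg_iff_add_eq_0)
    have "x \<noteq> 0" using e that(3,5) by auto
    moreover have "y \<noteq> 0" using e that(2) \<open>x \<noteq> 0\<close> by auto
    ultimately have "K m = K n" using scale[of x m] scale[of "- y" n] e by simp
    then show False using that(4) by simp
  qed
  show thesis
  proof (cases "frame n1 n2 n3")
    case True
    obtain u v w where "frame u v w" and d: "dot n1 u = 1" "dot n1 v = 0" "dot n1 w = 0"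
      "dot n2 u = 0" "dot n2 v = 1" "dot n2 w = 0" "dot n3 u = 0" "dot n3 v = 0" "dot n3 w = 1"
      by (rule dual_frame[OF True])
    then show thesis using Kh[of u v w n1] Kh[of u v w n2] Kh[of u v w n3] n1 n2 n3
      by (intro that[of u v w]) simp_all
  next
    case False
    then obtain x y z where e: "x *s n1 + y *s n2 + z *s n3 = 0" and nz: "x \<noteq> 0 \<or> y \<noteq> 0 \<or> z \<noteq> 0"
      unfolding frame_def by blast
    have z: "z \<noteq> 0"
      using depend[of x n1 y n2] e nz n1 n2 l(4) by auto
    have y: "y \<noteq> 0"
      using depend[of x n1 z n3] e nz n1 n3 l(5) by auto
    have x: "x \<noteq> 0"
      using depend[of y n2 z n3] e nz n2 n3 l(6) by auto
    define m1 where "m1 = x *s n1"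
    define m2 where "m2 = y *s n2"
    have m: "m1 \<noteq> 0" "m2 \<noteq> 0" "l1 = K m1" "l2 = K m2"
      using x y n1 n2 scale by (simp_all add: m1_def m2_def)
    have sum: "m1 + m2 = (- z) *s n3" using e by (simp add: m1_def m2_def eq_neg_iff_add_eq_0)
    then have l3: "l3 = K (m1 + m2)" using scale[of "- z" n3] z n3 by simp
    have "m2 \<notin> vec.span {m1}"
    proof
      assume "m2 \<in> vec.span {m1}"
      then obtain k where k: "m2 = k *s m1" unfolding vec.span_singleton by blast
      then have "k *s m1 + (- 1) *s m2 = 0" by simp
      then show False using depend[of k m1 "- 1" m2] m l(4) by simp
    qed
    moreover from this have "m1 \<noteq> m2" using vec.span_base[of m1 "{m1}"] by auto
    ultimately have "vec.independent (insert m2 {m1})" using m(1) by (simp add: vec.independent_insert)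
    then have "vec.independent {m1, m2}" by (simp add: insert_commute)
    then obtain r where r: "frame m1 m2 r" using \<open>m1 \<noteq> m2\<close> by (rule frame_extend)
    obtain u v w where "frame u v w" and d: "dot m1 u = 1" "dot m1 v = 0" "dot m1 w = 0"
      "dot m2 u = 0" "dot m2 v = 1" "dot m2 w = 0" "dot r u = 0" "dot r v = 0" "dot r w = 1"
      by (rule dual_frame[OF r])
    then show thesis using Kh[of u v w m1] Kh[of u v w m2] Kh[of u v w "m1 + m2"] m(3,4) l3
      by (intro that[of u v w]) simp_all
  qed
qed

lemma minimal_blocking_set_iff_tangents:
  "minimal_blocking_set S \<longleftrightarrow>
     blocking_set S \<and> (\<forall>P\<in>S. \<exists>l\<in>pg_lines. S \<inter> l = {P})"
proof
  assume m: "minimal_blocking_set S"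
  then have b: "blocking_set S" unfolding minimal_blocking_set_def by blast
  have "\<exists>l\<in>pg_lines. S \<inter> l = {P}" if "P \<in> S" for P
  proof -
    have "S - {P} \<subset> S" using that by blast
    then have "\<not> blocking_set (S - {P})" using m unfolding minimal_blocking_set_def by blast
    then obtain l where "l \<in> pg_lines" "(S - {P}) \<inter> l = {}"
      using b unfolding blocking_set_def by blast
    moreover from this have "S \<inter> l \<noteq> {}" using b unfolding blocking_set_def by blast
    ultimately have "S \<inter> l = {P}" by blast
    then show ?thesis using \<open>l \<in> pg_lines\<close> by blast
  qed
  then show "blocking_set S \<and> (\<forall>P\<in>S. \<exists>l\<in>pg_lines. S \<inter> l = {P})" using b by blast
next
  assume r: "blocking_set S \<and> (\<forall>P\<in>S. \<exists>l\<in>pg_lines. S \<inter> l = {P})"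
  have "\<not> blocking_set T" if T: "T \<subset> S" for T
  proof -
    obtain P where "P \<in> S" "P \<notin> T" using T by blast
    then obtain l where l: "l \<in> pg_lines" "S \<inter> l = {P}" using r by blast
    have "T \<inter> l \<subseteq> {P}" unfolding l(2)[symmetric] using T by (intro Int_mono) auto
    then have "T \<inter> l = {}" using \<open>P \<notin> T\<close> by (metis IntD1 empty_iff subset_singletonD insertI1)
    then have "\<not> (\<forall>l\<in>pg_lines. T \<inter> l \<noteq> {})" using l(1) by (intro notI) (drule (1) bspec, simp)
    then show ?thesis unfolding blocking_set_def by simp
  qed
  then show "minimal_blocking_set S" using r unfolding minimal_blocking_set_def by simp
qed

lemma pg_lines_cover:
  assumes "P \<in> pg_points"
  obtains l where "l \<in> pg_lines" "P \<in> l"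
proof -
  let ?e1 = "axis 1 1 :: 'a ^ 3" and ?e2 = "axis 2 1 :: 'a ^ 3" and ?e3 = "axis 3 1 :: 'a ^ 3"
  obtain x y z where P: "x \<noteq> 0 \<or> y \<noteq> 0 \<or> z \<noteq> 0" "P = hpt ?e1 ?e2 ?e3 x y z"
    by (rule pg_points_hpt[OF frame_axis assms])
  show thesis
  proof (cases "x = 0")
    case True
    have "P \<in> hline ?e1 ?e2 ?e3 1 0 0" unfolding P(2) using P(1) True by (intro hpt_in_hline) simp_all
    then show thesis by (intro that[OF hline_in_lines[OF frame_axis]]) simp_all
  next
    case False
    have "P \<in> hline ?e1 ?e2 ?e3 y (- x) 0" unfolding P(2) using P(1) by (intro hpt_in_hline) simp_all
    then show thesis using False by (intro that[OF hline_in_lines[OF frame_axis]]) simp_all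
  qed
qed

text \<open>
  That some set of lines covers \<open>S\<close> has to be shown first, since otherwise the minimum in the
  definition of the index would be unspecified.
\<close>

lemma pg_index_cover:
  assumes "S \<subseteq> pg_points"
  obtains L where "L \<subseteq> pg_lines" "card L = pg_index S" "S \<subseteq> \<Union> L"
proof -
  have "P \<in> \<Union> pg_lines" if P: "P \<in> S" for P
  proof -
    have "P \<in> pg_points" using assms P by blast
    then obtain l where "l \<in> pg_lines" "P \<in> l" by (rule pg_lines_cover)
    then show ?thesis by (rule UnionI)
  qed
  then have "S \<subseteq> \<Union> pg_lines" by (rule subsetI)
  then have "\<exists>k L. L \<subseteq> pg_lines \<and> card L = k \<and> S \<subseteq> \<Union> L"
    by (intro exI[of _ "card pg_lines"] exI[of _ pg_lines]) simp
  then have "\<exists>L. L \<subseteq> pg_lines \<and> card L = pg_index S \<and> S \<subseteq> \<Union> L"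
    unfolding pg_index_def by (rule LeastI_ex[where P = "\<lambda>k. \<exists>L. L \<subseteq> pg_lines \<and> card L = k \<and> S \<subseteq> \<Union> L"])
  then show thesis using that by blast
qed

section \<open>A blocking set on the sides of a triangle\<close>

text \<open>
  The equation of the distinguished blocking set. On the sides $x = 0$ and $y = 0$ it contains
  all points except the two with $y^2 = z^2$ or $x^2 = z^2$ respectively; on the side $z = 0$ it contains
  the two points with $x^2 = y^2$. The three vertices satisfy one of the first two conditions.
\<close>

definition tri_zero :: "'a::field \<Rightarrow> 'a \<Rightarrow> 'a \<Rightarrow> bool" where
  "tri_zero x y z \<longleftrightarrow> (x = 0 \<and> y\<^sup>2 \<noteq> z\<^sup>2) \<or> (y = 0 \<and> x\<^sup>2 \<noteq> z\<^sup>2) \<or> (z = 0 \<and> x\<^sup>2 = y\<^sup>2)"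

text \<open>
  The distinguished blocking set with respect to a frame.
\<close>

definition tri_set :: "'a::{field,finite} ^ 3 \<Rightarrow> 'a ^ 3 \<Rightarrow> 'a ^ 3 \<Rightarrow> ('a ^ 3) set set" where
  "tri_set u v w = {hpt u v w x y z | x y z. (x \<noteq> 0 \<or> y \<noteq> 0 \<or> z \<noteq> 0) \<and> tri_zero x y z}"

lemma tri_zero_scale: "c \<noteq> 0 \<Longrightarrow> tri_zero (c * x) (c * y) (c * z) \<longleftrightarrow> tri_zero x y z"
  by (simp add: tri_zero_def power_mult_distrib)

lemma hpt_in_tri_set_iff:
  assumes "frame u v w" "x \<noteq> 0 \<or> y \<noteq> 0 \<or> z \<noteq> 0"
  shows "hpt u v w x y z \<in> tri_set u v w \<longleftrightarrow> tri_zero x y z"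
proof
  assume "hpt u v w x y z \<in> tri_set u v w"
  then obtain x' y' z' where *: "hpt u v w x y z = hpt u v w x' y' z'" "tri_zero x' y' z'"
    unfolding tri_set_def by blast
  obtain c where "c \<noteq> 0" "x = c * x'" "y = c * y'" "z = c * z'"
    using *(1) hpt_eq_iff[OF assms] by blast
  then show "tri_zero x y z" using *(2) by (simp add: tri_zero_scale)
next
  assume "tri_zero x y z"
  then show "hpt u v w x y z \<in> tri_set u v w" unfolding tri_set_def using assms(2) by blast
qed

lemma tri_setE:
  assumes "P \<in> tri_set u v w"
  obtains x y z where "x \<noteq> 0 \<or> y \<noteq> 0 \<or> z \<noteq> 0" "tri_zero x y z" "P = hpt u v w x y z"
  using assms unfolding tri_set_def by blast

lemma tri_set_subset_points:
  assumes "frame u v w" shows "tri_set u v w \<subseteq> pg_points"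
proof
  fix P assume "P \<in> tri_set u v w"
  then show "P \<in> pg_points" by (rule tri_setE) (simp add: hpt_in_points[OF assms])
qed

text \<open>
  A line other than a side meets the sides in $(0 : c : -b)$, $(c : 0 : -a)$ and $(b : -a : 0)$.
  If the first two are not in the set, then $a^2 = b^2 = c^2$, and the third one is. The sides contain
  vertices.
\<close>

lemma tri_set_meets_line:
  assumes f: "frame u v w" and abc: "a \<noteq> 0 \<or> b \<noteq> 0 \<or> c \<noteq> 0"
  shows "tri_set u v w \<inter> hline u v w a b c \<noteq> {}"
proof -
  have *: ?thesis if "x \<noteq> 0 \<or> y \<noteq> 0 \<or> z \<noteq> 0" "tri_zero x y z" "a * x + b * y + c * z = 0" for x y z
    using hpt_in_tri_set_iff[OF f that(1)] hpt_in_hline_iff[OF f that(1)] that by blast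
  consider "a = 0" "b = 0" | "b\<^sup>2 \<noteq> c\<^sup>2" | "a\<^sup>2 \<noteq> c\<^sup>2" | "a\<^sup>2 = c\<^sup>2" "b\<^sup>2 = c\<^sup>2" "a \<noteq> 0 \<or> b \<noteq> 0" by blast
  then show ?thesis
  proof cases
    case 1 then show ?thesis by (intro *[of 1 0 0]) (simp_all add: tri_zero_def)
  next
    case 2 then show ?thesis by (intro *[of 0 c "- b"]) (auto simp: tri_zero_def)
  next
    case 3 then show ?thesis by (intro *[of c 0 "- a"]) (auto simp: tri_zero_def)
  next
    case 4 then show ?thesis by (intro *[of b "- a" 0]) (auto simp: tri_zero_def)
  qed
qed

lemma tri_set_not_contains_line:
  assumes f: "frame u v w" and abc: "a \<noteq> 0 \<or> b \<noteq> 0 \<or> c \<noteq> 0" and q: "(2::'a::{field,finite}) \<noteq> 0" "(3::'a) \<noteq> 0"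
  shows "\<not> hline u v w a b (c :: 'a) \<subseteq> tri_set u v w"
proof -
  have *: ?thesis if "x \<noteq> 0 \<or> y \<noteq> 0 \<or> z \<noteq> 0" "\<not> tri_zero x y z" "a * x + b * y + c * z = 0" for x y z
    using hpt_in_tri_set_iff[OF f that(1)] hpt_in_hline_iff[OF f that(1)] that by blast
  have 4: "(1::'a) \<noteq> 4"
  proof
    assume "(1::'a) = 4"
    then have "(4::'a) - 1 = 4 - 4" by (rule arg_cong)
    then show False using q(2) by simp
  qed
  consider "b = 0" "c = 0" | "a = 0" "c = 0" | "a = 0" "b = 0"
    | "a = 0" "b \<noteq> 0" "c \<noteq> 0" | "b = 0" "a \<noteq> 0" "c \<noteq> 0" | "c = 0" "a \<noteq> 0" "b \<noteq> 0"
    | "a \<noteq> 0" "b \<noteq> 0" "c \<noteq> 0" by blast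
  then show ?thesis
  proof cases
    case 1 then show ?thesis by (intro *[of 0 1 1]) (simp_all add: tri_zero_def)
  next
    case 2 then show ?thesis by (intro *[of 1 0 1]) (simp_all add: tri_zero_def)
  next
    case 3 then show ?thesis using 4 q(1) by (intro *[of 1 2 0]) (simp_all add: tri_zero_def)
  next
    case 4 then show ?thesis by (intro *[of 1 c "- b"]) (simp_all add: tri_zero_def)
  next
    case 5 then show ?thesis by (intro *[of c 1 "- a"]) (simp_all add: tri_zero_def)
  next
    case 6 then show ?thesis by (intro *[of b "- a" 1]) (simp_all add: tri_zero_def)
  next
    \<comment> \<open>a point with no coordinate 0; this needs $2 \ne 0$\<close>
    case 7 then show ?thesis using q(1)
      by (intro *[of "b * c" "a * c" "- (2 * a * b)"]) (simp_all add: tri_zero_def algebra_simps)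
  qed
qed

text \<open>
  Tangents are $x + 2 y = 0$ at $(0 : 0 : 1)$, and $y x' - z y' + y z' = 0$, $- z x' + x y' + x z' = 0$,
  $y x' - x y' + y z' = 0$ at the other points $(x : y : z)$ on $x = 0$, $y = 0$ and, vertices excluded,
  $z = 0$.
\<close>

lemma tri_set_tangent:
  assumes f: "frame u v w" and q: "(2::'a::{field,finite}) \<noteq> 0" "(3::'a) \<noteq> 0"
    and P: "P \<in> tri_set u v (w :: 'a ^ 3)"
  shows "\<exists>l\<in>pg_lines. tri_set u v w \<inter> l = {P}"
proof -
  obtain x y z where xyz: "x \<noteq> 0 \<or> y \<noteq> 0 \<or> z \<noteq> 0" and t: "tri_zero x y z" and P_eq: "P = hpt u v w x y z"
    using P by (rule tri_setE)
  have *: ?thesis if n: "a \<noteq> 0 \<or> b \<noteq> 0 \<or> c \<noteq> 0" and "a * x + b * y + c * z = 0"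
    and uniq: "\<And>x' y' z'. x' \<noteq> 0 \<or> y' \<noteq> 0 \<or> z' \<noteq> 0 \<Longrightarrow> tri_zero x' y' z' \<Longrightarrow>
      a * x' + b * y' + c * z' = 0 \<Longrightarrow> \<exists>k. k \<noteq> 0 \<and> x' = k * x \<and> y' = k * y \<and> z' = k * z" for a b c
  proof (rule bexI[OF _ hline_in_lines[OF f n]])
    have eq: "Q = P" if Q: "Q \<in> tri_set u v w" "Q \<in> hline u v w a b c" for Q
    proof -
      obtain x' y' z' where q: "x' \<noteq> 0 \<or> y' \<noteq> 0 \<or> z' \<noteq> 0" "tri_zero x' y' z'" "Q = hpt u v w x' y' z'"
        using Q(1) by (rule tri_setE)
      have "a * x' + b * y' + c * z' = 0" using Q(2) hpt_in_hline_iff[OF f q(1)] q(3) by simp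
      then show ?thesis unfolding P_eq q(3) hpt_eq_iff[OF f q(1)] by (rule uniq[OF q(1,2)])
    qed
    have Pl: "P \<in> hline u v w a b c" unfolding P_eq using xyz that(2) by (rule hpt_in_hline)
    show "tri_set u v w \<inter> hline u v w a b c = {P}"
    proof (rule subset_antisym)
      show "tri_set u v w \<inter> hline u v w a b c \<subseteq> {P}"
        by (intro subsetI singleton_iff[THEN iffD2] eq) simp_all
      show "{P} \<subseteq> tri_set u v w \<inter> hline u v w a b c" using P Pl by simp
    qed
  qed
  have 4: "(4::'a) \<noteq> 1"
  proof
    assume "(4::'a) = 1"
    then have "(4::'a) - 1 = 1 - 1" by (rule arg_cong)
    then show False using q(2) by simp
  qed
  consider "x = 0" "y = 0" "z \<noteq> 0" | "x = 0" "y \<noteq> 0" "y\<^sup>2 \<noteq> z\<^sup>2" | "y = 0" "x \<noteq> 0" "x\<^sup>2 \<noteq> z\<^sup>2"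
    | "x \<noteq> 0" "y \<noteq> 0" "z = 0" "x\<^sup>2 = y\<^sup>2"
    using t xyz unfolding tri_zero_def by (cases "x = 0"; cases "y = 0"; cases "z = 0"; auto)
  then show ?thesis
  proof cases
    case 1
    show ?thesis
    proof (rule *[of 1 2 0])
      fix x' y' z' :: 'a
      assume h: "x' \<noteq> 0 \<or> y' \<noteq> 0 \<or> z' \<noteq> 0" "tri_zero x' y' z'" "1 * x' + 2 * y' + 0 * z' = 0"
      then have x': "x' = - 2 * y'" by (simp add: eq_neg_iff_add_eq_0)
      have "y' = 0"
      proof (rule ccontr)
        assume y': "y' \<noteq> 0"
        then have "x' \<noteq> 0" using x' q(1) by simp
        then have "x'\<^sup>2 = y'\<^sup>2" using h(2) y' unfolding tri_zero_def by simp
        then have "4 * y'\<^sup>2 = 1 * y'\<^sup>2" using x' by (simp add: power_mult_distrib)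
        then have "(4::'a) = 1" using y' by (simp only: mult_cancel_right power_eq_0_iff) simp
        then show False using 4 by simp
      qed
      then show "\<exists>k. k \<noteq> 0 \<and> x' = k * x \<and> y' = k * y \<and> z' = k * z"
        using h(1) x' 1 by (intro exI[of _ "z' / z"]) simp
    qed (use 1 in simp_all)
  next
    case 2
    show ?thesis
    proof (rule *[of y "- z" y])
      fix x' y' z' :: 'a
      assume h: "x' \<noteq> 0 \<or> y' \<noteq> 0 \<or> z' \<noteq> 0" "tri_zero x' y' z'" "y * x' + - z * y' + y * z' = 0"
      then have e: "z * y' = y * (x' + z')" by (simp add: algebra_simps eq_neg_iff_add_eq_0)
      have x': "x' = 0"
      proof (rule ccontr)
        assume x': "x' \<noteq> 0"
        show False
        proof (cases "y' = 0")
          case True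
          then have "x' + z' = 0" using e 2 by simp
          then have z': "z' = - x'" by (simp add: eq_neg_iff_add_eq_0 add.commute)
          then show False using h(2) x' True unfolding tri_zero_def by simp
        next
          case False
          then have s: "z' = 0" "x'\<^sup>2 = y'\<^sup>2" using h(2) x' unfolding tri_zero_def by auto
          have "(z * y')\<^sup>2 = (y * x')\<^sup>2" using e s(1) by simp
          then have "z\<^sup>2 * y'\<^sup>2 = y\<^sup>2 * y'\<^sup>2" using s(2) by (simp add: power_mult_distrib)
          then show False using False 2 by simp
        qed
      qed
      then have z': "z' = z * y' / y" using e 2 by (simp add: field_simps)
      then have "y' \<noteq> 0" using h(1) x' by auto
      then show "\<exists>k. k \<noteq> 0 \<and> x' = k * x \<and> y' = k * y \<and> z' = k * z"
        using x' z' 2 by (intro exI[of _ "y' / y"]) simp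
    qed (use 2 in simp_all)
  next
    case 3
    show ?thesis
    proof (rule *[of "- z" x x])
      fix x' y' z' :: 'a
      assume h: "x' \<noteq> 0 \<or> y' \<noteq> 0 \<or> z' \<noteq> 0" "tri_zero x' y' z'" "- z * x' + x * y' + x * z' = 0"
      then have e: "z * x' = x * (y' + z')" by (simp add: algebra_simps eq_neg_iff_add_eq_0)
      have y': "y' = 0"
      proof (rule ccontr)
        assume y': "y' \<noteq> 0"
        show False
        proof (cases "x' = 0")
          case True
          then have "y' + z' = 0" using e 3 by simp
          then have z': "z' = - y'" by (simp add: eq_neg_iff_add_eq_0 add.commute)
          then show False using h(2) y' True unfolding tri_zero_def by simp
        next
          case False
          then have s: "z' = 0" "x'\<^sup>2 = y'\<^sup>2" using h(2) y' unfolding tri_zero_def by auto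
          have "(z * x')\<^sup>2 = (x * y')\<^sup>2" using e s(1) by simp
          then have "z\<^sup>2 * y'\<^sup>2 = x\<^sup>2 * y'\<^sup>2" using s(2) by (simp add: power_mult_distrib)
          then show False using y' 3 by simp
        qed
      qed
      then have z': "z' = z * x' / x" using e 3 by (simp add: field_simps)
      then have "x' \<noteq> 0" using h(1) y' by auto
      then show "\<exists>k. k \<noteq> 0 \<and> x' = k * x \<and> y' = k * y \<and> z' = k * z"
        using y' z' 3 by (intro exI[of _ "x' / x"]) simp
    qed (use 3 in simp_all)
  next
    case 4
    show ?thesis
    proof (rule *[of y "- x" y])
      fix x' y' z' :: 'a
      assume h: "x' \<noteq> 0 \<or> y' \<noteq> 0 \<or> z' \<noteq> 0" "tri_zero x' y' z'" "y * x' + - x * y' + y * z' = 0"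
      then have e: "x * y' = y * (x' + z')" by (simp add: algebra_simps eq_neg_iff_add_eq_0)
      have "(x * y')\<^sup>2 = (y * (x' + z'))\<^sup>2" using e by simp
      then have sq: "y'\<^sup>2 = (x' + z')\<^sup>2" using 4 by (simp add: power_mult_distrib)
      have z': "z' = 0"
      proof (rule ccontr)
        assume z': "z' \<noteq> 0"
        then consider "x' = 0" "y'\<^sup>2 \<noteq> z'\<^sup>2" | "y' = 0" "x'\<^sup>2 \<noteq> z'\<^sup>2" using h(2) unfolding tri_zero_def by blast
        then show False
        proof cases
          case 1 then show False using sq by simp
        next
          case 2
          then have "x' + z' = 0" using sq by simp
          then have "z' = - x'" by (simp add: eq_neg_iff_add_eq_0 add.commute)
          then show False using 2 by simp
        qed
      qed
      then have x': "x' = x * y' / y" using e 4 by (simp add: field_simps)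
      then have "y' \<noteq> 0" using h(1) z' by auto
      then show "\<exists>k. k \<noteq> 0 \<and> x' = k * x \<and> y' = k * y \<and> z' = k * z"
        using x' z' 4 by (intro exI[of _ "y' / y"]) simp
    qed (use 4 in simp_all)
  qed
qed

section \<open>Counting points on the sides of a triangle\<close>

text \<open>
  Points $(0 : 1 : -a)$ on the side $x = 0$ of the triangle. For nonzero \<open>a\<close> this parametrises the
  points of the side other than the vertices. With the sign, and the same parametrisation of the
  other sides in the rotated frames, the points with parameters \<open>a\<close>, \<open>b\<close>, \<open>c\<close> are collinear if and only if
  $abc = 1$ (Menelaus).
\<close>

definition side :: "'a::{field,finite} ^ 3 \<Rightarrow> 'a ^ 3 \<Rightarrow> 'a ^ 3 \<Rightarrow> 'a set \<Rightarrow> ('a ^ 3) set set" where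
  "side u v w X = (\<lambda>a. hpt u v w 0 1 (- a)) ` X"

lemma card_side:
  assumes "frame u v w" shows "card (side u v w X) = card X"
proof -
  have "inj_on (\<lambda>a. hpt u v w 0 1 (- a)) X"
    by (rule inj_onI) (simp add: hpt_eq_iff[OF assms])
  then show ?thesis unfolding side_def by (rule card_image)
qed

lemma side_rotate:
  "side v w u X = (\<lambda>b. hpt u v w (- b) 0 1) ` X"
  "side w u v X = (\<lambda>c. hpt u v w 1 (- c) 0) ` X"
  using hpt_rotate[where u = u and v = v and w = w and y = 0 and z = 1]
    hpt_rotate[where u = v and v = w and w = u and y = 0 and z = 1]
    hpt_rotate[where u = u and v = v and w = w and x = 1 and z = 0]
  by (simp_all add: side_def)

lemma sides_disjoint:
  assumes "frame u v w" "0 \<notin> X" "0 \<notin> Y"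
  shows "side u v w X \<inter> side v w u Y = {}"
  unfolding side_def[of u v w X] side_rotate(1)[of v w u Y] using assms(2,3)
  by (auto simp: hpt_eq_iff[OF assms(1)])

lemma card_sides:
  assumes "frame u v w" "0 \<notin> X" "0 \<notin> Y" "0 \<notin> Z"
  shows "card (side u v w X \<union> side v w u Y \<union> side w u v Z) = card X + card Y + card Z"
proof -
  have f: "frame v w u" "frame w u v" using assms(1) frame_rotate by blast+
  have "side u v w X \<inter> side v w u Y = {}" "side v w u Y \<inter> side w u v Z = {}" "side w u v Z \<inter> side u v w X = {}"
    using sides_disjoint assms f by blast+
  then have "(side u v w X \<union> side v w u Y) \<inter> side w u v Z = {}" by blast
  then show ?thesis
    using \<open>side u v w X \<inter> side v w u Y = {}\<close> card_side[OF assms(1)] card_side[OF f(1)] card_side[OF f(2)]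
    by (simp add: card_Un_disjoint)
qed

text \<open>
  The parameters of the points of \<open>S\<close> on the side $x = 0$, without the vertices.
\<close>

definition on_side :: "('a::{field,finite} ^ 3) set set \<Rightarrow> 'a ^ 3 \<Rightarrow> 'a ^ 3 \<Rightarrow> 'a ^ 3 \<Rightarrow> 'a set" where
  "on_side S u v w = {a. a \<noteq> 0 \<and> hpt u v w 0 1 (- a) \<in> S}"

lemma zero_notin_on_side [simp]: "0 \<notin> on_side S u v w"
  by (simp add: on_side_def)

lemma side_on_side_subset: "side u v w (on_side S u v w) \<subseteq> S"
  by (auto simp: side_def on_side_def)

lemma on_side_rotate:
  "on_side S v w u = {b. b \<noteq> 0 \<and> hpt u v w (- b) 0 1 \<in> S}"
  "on_side S w u v = {c. c \<noteq> 0 \<and> hpt u v w 1 (- c) 0 \<in> S}"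
  using hpt_rotate[where u = u and v = v and w = w and y = 0 and z = 1]
    hpt_rotate[where u = v and v = w and w = u and y = 0 and z = 1]
    hpt_rotate[where u = u and v = v and w = w and x = 1 and z = 0]
  by (simp_all add: on_side_def)

lemma side_line_cases:
  assumes f: "frame u v w" and S: "S \<subseteq> pg_points" and P: "P \<in> S" "P \<in> hline u v w 1 0 0"
  shows "P \<in> (S \<inter> {hpt u v w 0 1 0, hpt u v w 0 0 1}) \<union> side u v w (on_side S u v w)"
proof -
  have "P \<in> pg_points" using S P(1) by (rule subsetD)
  then obtain x y z where xyz: "x \<noteq> 0 \<or> y \<noteq> 0 \<or> z \<noteq> 0" "P = hpt u v w x y z" by (rule pg_points_hpt[OF f])
  have x: "x = 0" using P(2) hpt_in_hline_iff[OF f xyz(1)] xyz(2) by simp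
  show ?thesis
  proof (cases "y = 0")
    case True
    then have "P = hpt u v w 0 0 1" using x xyz hpt_scale[of z u v w 0 0 1] by simp
    then show ?thesis using P(1) by simp
  next
    case y: False
    show ?thesis
    proof (cases "z = 0")
      case True
      then have "P = hpt u v w 0 1 0" using x y xyz(2) hpt_scale[of y u v w 0 1 0] by simp
      then show ?thesis using P(1) by simp
    next
      case False
      have e: "P = hpt u v w 0 1 (- (- (z / y)))" using x y xyz(2) hpt_scale[of y u v w 0 1 "z / y"] by simp
      then have "- (z / y) \<in> on_side S u v w" using y False P(1) by (simp add: on_side_def)
      then have "P \<in> side u v w (on_side S u v w)" unfolding side_def using e by (intro image_eqI)
      then show ?thesis by simp
    qed
  qed
qed

lemma vertices_on_side_line:
  assumes f: "frame u v w"
  shows "{hpt u v w 0 1 0, hpt u v w 0 0 1} \<subseteq> hline u v w 1 0 0"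
    "side u v w X \<subseteq> hline u v w 1 0 0"
  by (auto simp: side_def intro!: hpt_in_hline)

lemma vertex_notin_side:
  assumes f: "frame u v w" and "0 \<notin> X"
  shows "hpt u v w 1 0 0 \<notin> side u v w X" "hpt u v w 0 1 0 \<notin> side u v w X" "hpt u v w 0 0 1 \<notin> side u v w X"
  using assms(2) by (auto simp: side_def hpt_eq_iff[OF f])

lemma vertices_distinct:
  assumes f: "frame u v w"
  shows "hpt u v w 1 0 0 \<noteq> hpt u v w 0 1 0" "hpt u v w 1 0 0 \<noteq> hpt u v w 0 0 1"
    "hpt u v w 0 1 0 \<noteq> hpt u v w 0 0 1"
  by (auto simp: hpt_eq_iff[OF f])

lemma card_side_line:
  assumes f: "frame u v w" and S: "S \<subseteq> pg_points"
  shows "card (S \<inter> hline u v w 1 0 0) =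
    card (S \<inter> {hpt u v w 0 1 0, hpt u v w 0 0 1}) + card (on_side S u v w)"
proof -
  let ?V = "S \<inter> {hpt u v w 0 1 0, hpt u v w 0 0 1}" and ?X = "side u v w (on_side S u v w)"
  have "S \<inter> hline u v w 1 0 0 = ?V \<union> ?X"
  proof (rule subset_antisym)
    show "S \<inter> hline u v w 1 0 0 \<subseteq> ?V \<union> ?X"
      by (rule subsetI, erule IntE, rule side_line_cases[OF f S])
    show "?V \<union> ?X \<subseteq> S \<inter> hline u v w 1 0 0"
      by (intro Un_least Int_greatest Int_lower1 side_on_side_subset vertices_on_side_line(2)[OF f])
        (rule subset_trans[OF Int_lower2 vertices_on_side_line(1)[OF f]])
  qed
  moreover have "?V \<inter> ?X = {}"
    using vertex_notin_side[OF f zero_notin_on_side[of S u v w]] unfolding disjoint_iff by auto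
  ultimately show ?thesis by (simp add: card_Un_disjoint card_side[OF f])
qed

lemma card_triangle:
  assumes f: "frame u v w" and S: "S \<subseteq> pg_points"
    and cover: "S \<subseteq> hline u v w 1 0 0 \<union> hline u v w 0 1 0 \<union> hline u v w 0 0 1"
  shows "card S = card (S \<inter> {hpt u v w 1 0 0, hpt u v w 0 1 0, hpt u v w 0 0 1})
    + (card (on_side S u v w) + card (on_side S v w u) + card (on_side S w u v))"
proof -
  have f': "frame v w u" "frame w u v" using f frame_rotate by blast+
  have V: "hpt v w u 0 0 1 = hpt u v w 1 0 0" "hpt v w u 1 0 0 = hpt u v w 0 1 0" "hpt v w u 0 1 0 = hpt u v w 0 0 1"
    "hpt w u v 0 1 0 = hpt u v w 1 0 0" "hpt w u v 0 0 1 = hpt u v w 0 1 0" "hpt w u v 1 0 0 = hpt u v w 0 0 1"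
    using hpt_rotate[of v w u] hpt_rotate[of w u v] by simp_all
  let ?V = "S \<inter> {hpt u v w 1 0 0, hpt u v w 0 1 0, hpt u v w 0 0 1}"
  let ?X = "side u v w (on_side S u v w)" and ?Y = "side v w u (on_side S v w u)"
    and ?Z = "side w u v (on_side S w u v)"
  have "P \<in> ?V \<union> (?X \<union> ?Y \<union> ?Z)" if P: "P \<in> S" for P
  proof -
    have "P \<in> hline u v w 1 0 0 \<or> P \<in> hline v w u 1 0 0 \<or> P \<in> hline w u v 1 0 0"
      using cover P hline_rotate[of v w u 1 0 0] hline_rotate[of w u v 1 0 0] hline_rotate[of v w u 0 1 0] by auto
    then show ?thesis
      using side_line_cases[OF f S P] side_line_cases[OF f'(1) S P] side_line_cases[OF f'(2) S P]
      unfolding V by auto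
  qed
  then have S_eq: "S = ?V \<union> (?X \<union> ?Y \<union> ?Z)"
    using side_on_side_subset[of u v w S] side_on_side_subset[of v w u S] side_on_side_subset[of w u v S]
    by (intro subset_antisym subsetI) auto
  have dis: "?V \<inter> (?X \<union> ?Y \<union> ?Z) = {}"
    using vertex_notin_side[OF f zero_notin_on_side[of S u v w]] vertex_notin_side[OF f'(1) zero_notin_on_side[of S v w u]]
      vertex_notin_side[OF f'(2) zero_notin_on_side[of S w u v]]
    unfolding V disjoint_iff by auto
  have "card S = card (?V \<union> (?X \<union> ?Y \<union> ?Z))" using S_eq by (rule arg_cong)
  also have "\<dots> = card ?V + card (?X \<union> ?Y \<union> ?Z)" using dis by (intro card_Un_disjoint) simp_all
  finally show ?thesis by (simp add: card_sides[OF f])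
qed

lemma card_units_square:
  assumes "CARD('a::{field,finite}) = 7"
  shows "card {a::'a. a \<noteq> 0 \<and> a\<^sup>2 = 1} = 2" "card {a::'a. a \<noteq> 0 \<and> a\<^sup>2 \<noteq> 1} = 4"
proof -
  have ne: "(1::'a) \<noteq> - 1" using field_7_facts(2)[OF assms] by (metis one_add_one add.right_inverse)
  have "{a::'a. a \<noteq> 0 \<and> a\<^sup>2 = 1} = {1, - 1}" by (auto simp: power2_eq_1_iff)
  then show "card {a::'a. a \<noteq> 0 \<and> a\<^sup>2 = 1} = 2" using ne by simp
  have "{a::'a. a \<noteq> 0 \<and> a\<^sup>2 \<noteq> 1} = UNIV - {0, 1, - 1}" by (auto simp: power2_eq_1_iff)
  then show "card {a::'a. a \<noteq> 0 \<and> a\<^sup>2 \<noteq> 1} = 4" using ne assms by (simp add: card_Diff_subset)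
qed

lemma hline_scale:
  assumes f: "frame u v w" and "k \<noteq> 0"
  shows "hline u v w (k * a) (k * b) (k * c) = hline u v w a b c"
proof -
  have "k * a * x + k * b * y + k * c * z = k * (a * x + b * y + c * z)" for x y z by (simp add: algebra_simps)
  then have "k * a * x + k * b * y + k * c * z = 0 \<longleftrightarrow> a * x + b * y + c * z = 0" for x y z using assms(2) by simp
  then show ?thesis unfolding hline_def by simp
qed

lemma tri_set_on_side:
  assumes f: "frame u v w"
  shows "on_side (tri_set u v w) u v w = {a. a \<noteq> 0 \<and> a\<^sup>2 \<noteq> 1}"
    "on_side (tri_set u v w) v w u = {a. a \<noteq> 0 \<and> a\<^sup>2 \<noteq> 1}"
    "on_side (tri_set u v w) w u v = {a. a \<noteq> 0 \<and> a\<^sup>2 = 1}"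
  unfolding on_side_def[of _ u v w] on_side_rotate[of _ v w u] on_side_rotate(2)[of _ w u v]
  by (auto simp: hpt_in_tri_set_iff[OF f] tri_zero_def)

lemma tri_set_vertices:
  assumes f: "frame u v w"
  shows "hpt u v w 1 0 0 \<in> tri_set u v w" "hpt u v w 0 1 0 \<in> tri_set u v w" "hpt u v w 0 0 1 \<in> tri_set u v w"
  by (simp_all add: hpt_in_tri_set_iff[OF f] tri_zero_def)

lemma tri_set_cover:
  "tri_set u v w \<subseteq> hline u v w 1 0 0 \<union> hline u v w 0 1 0 \<union> hline u v w 0 0 1"
proof
  fix P assume "P \<in> tri_set u v w"
  then obtain x y z where "x \<noteq> 0 \<or> y \<noteq> 0 \<or> z \<noteq> 0" "tri_zero x y z" "P = hpt u v w x y z" by (rule tri_setE)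
  then show "P \<in> hline u v w 1 0 0 \<union> hline u v w 0 1 0 \<union> hline u v w 0 0 1"
    using hpt_in_hline[of x y z 1 0 0 u v w] hpt_in_hline[of x y z 0 1 0 u v w] hpt_in_hline[of x y z 0 0 1 u v w]
    unfolding tri_zero_def by auto
qed

lemma card_tri_set:
  assumes q: "CARD('a::{field,finite}) = 7" and f: "frame u v (w :: 'a ^ 3)"
  shows "card (tri_set u v w) = 13"
proof -
  have "tri_set u v w \<inter> {hpt u v w 1 0 0, hpt u v w 0 1 0, hpt u v w 0 0 1}
      = {hpt u v w 1 0 0, hpt u v w 0 1 0, hpt u v w 0 0 1}"
    using tri_set_vertices[OF f] by (intro Int_absorb1) simp
  then show ?thesis
    using card_triangle[OF f tri_set_subset_points[OF f] tri_set_cover] vertices_distinct[OF f]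
    by (simp add: tri_set_on_side[OF f] card_units_square[OF q])
qed

lemma card_tri_set_axis_lines:
  assumes q: "CARD('a::{field,finite}) = 7" and f: "frame u v (w :: 'a ^ 3)"
  shows "card (tri_set u v w \<inter> hline u v w 1 0 0) = 6"
    "card (tri_set u v w \<inter> hline u v w 0 1 0) \<le> 6"
    "card (tri_set u v w \<inter> hline u v w 0 0 1) \<le> 6"
proof -
  note S = tri_set_subset_points[OF f]
  have f': "frame v w u" "frame w u v" using f frame_rotate by blast+
  have "tri_set u v w \<inter> {hpt u v w 0 1 0, hpt u v w 0 0 1} = {hpt u v w 0 1 0, hpt u v w 0 0 1}"
    using tri_set_vertices[OF f] by (intro Int_absorb1) simp
  then show "card (tri_set u v w \<inter> hline u v w 1 0 0) = 6"
    using card_side_line[OF f S] vertices_distinct[OF f]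
    by (simp add: tri_set_on_side[OF f] card_units_square[OF q])
  have 2: "card (X \<inter> {P, Q}) \<le> 2" for X and P Q :: "('a ^ 3) set"
    by (rule order_trans[OF card_mono[of "{P, Q}"]]) (simp_all add: card_insert_if)
  show "card (tri_set u v w \<inter> hline u v w 0 1 0) \<le> 6"
    using card_side_line[OF f'(1) S] 2[of "tri_set u v w" "hpt v w u 0 1 0" "hpt v w u 0 0 1"]
    by (simp add: tri_set_on_side[OF f] card_units_square[OF q] hline_rotate[of v w u 1 0 0])
  show "card (tri_set u v w \<inter> hline u v w 0 0 1) \<le> 6"
    using card_side_line[OF f'(2) S] 2[of "tri_set u v w" "hpt w u v 0 1 0" "hpt w u v 0 0 1"]
    by (simp add: tri_set_on_side[OF f] card_units_square[OF q] hline_rotate[of w u v 1 0 0] hline_rotate[of v w u 0 1 0])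
qed

lemma orthogonal_pair:
  fixes b c y z :: "'a::field"
  assumes "b \<noteq> 0 \<or> c \<noteq> 0" "b * y + c * z = 0"
  obtains k where "y = k * c" "z = k * (- b)"
proof (cases "c = 0")
  case True
  then show thesis using assms that[of "- (z / b)"] by simp
next
  case False
  have "z = y / c * (- b)" using assms(2) False by (simp add: field_simps eq_neg_iff_add_eq_0)
  then show thesis using that[of "y / c"] False by simp
qed

lemma card_tri_set_line:
  assumes q: "CARD('a::{field,finite}) = 7" and f: "frame u v (w :: 'a ^ 3)" and l: "l \<in> pg_lines"
  shows "card (tri_set u v w \<inter> l) \<le> 6"
proof -
  obtain a b c where abc: "a \<noteq> 0 \<or> b \<noteq> 0 \<or> c \<noteq> 0" and l_eq: "l = hline u v w a b c"
    using l by (rule pg_line_is_hline[OF f])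
  note axis = card_tri_set_axis_lines[OF q f]
  consider "b = 0" "c = 0" "a \<noteq> 0" | "a = 0" "c = 0" "b \<noteq> 0" | "a = 0" "b = 0" "c \<noteq> 0"
    | "b \<noteq> 0 \<or> c \<noteq> 0" "a \<noteq> 0 \<or> c \<noteq> 0" "a \<noteq> 0 \<or> b \<noteq> 0" using abc by blast
  then show ?thesis
  proof cases
    case 1 then show ?thesis using axis(1) hline_scale[OF f, of a 1 0 0] l_eq by simp
  next
    case 2 then show ?thesis using axis(2) hline_scale[OF f, of b 0 1 0] l_eq by simp
  next
    case 3 then show ?thesis using axis(3) hline_scale[OF f, of c 0 0 1] l_eq by simp
  next
    case 4
    have "tri_set u v w \<inter> l \<subseteq> {hpt u v w 0 c (- b), hpt u v w c 0 (- a), hpt u v w b (- a) 0}"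
    proof (rule subsetI, erule IntE)
      fix P assume P: "P \<in> tri_set u v w" "P \<in> l"
      obtain x y z where p: "x \<noteq> 0 \<or> y \<noteq> 0 \<or> z \<noteq> 0" "tri_zero x y z" "P = hpt u v w x y z" using P(1) by (rule tri_setE)
      have e: "a * x + b * y + c * z = 0" using P(2) p(3) hpt_in_hline_iff[OF f p(1)] l_eq by simp
      consider "x = 0" | "y = 0" | "z = 0" using p(2) unfolding tri_zero_def by blast
      then have "P = hpt u v w 0 c (- b) \<or> P = hpt u v w c 0 (- a) \<or> P = hpt u v w b (- a) 0"
      proof cases
        case 1
        obtain k where k: "y = k * c" "z = k * (- b)" using 4(1) e 1 by (auto intro: orthogonal_pair[of b c y z])
        have "k \<noteq> 0" using k p(1) 1 by auto
        then have "P = hpt u v w 0 c (- b)" using hpt_scale[of k u v w 0 c "- b"] k p(3) 1 by simp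
        then show ?thesis by simp
      next
        case 2
        obtain k where k: "x = k * c" "z = k * (- a)" using 4(2) e 2 by (auto intro: orthogonal_pair[of a c x z])
        have "k \<noteq> 0" using k p(1) 2 by auto
        then have "P = hpt u v w c 0 (- a)" using hpt_scale[of k u v w c 0 "- a"] k p(3) 2 by simp
        then show ?thesis by simp
      next
        case 3
        obtain k where k: "x = k * b" "y = k * (- a)" using 4(3) e 3 by (auto intro: orthogonal_pair[of a b x y])
        have "k \<noteq> 0" using k p(1) 3 by auto
        then have "P = hpt u v w b (- a) 0" using hpt_scale[of k u v w b "- a" 0] k p(3) 3 by simp
        then show ?thesis by simp
      qed
      then show "P \<in> {hpt u v w 0 c (- b), hpt u v w c 0 (- a), hpt u v w b (- a) 0}" by simp
    qed
    then have "card (tri_set u v w \<inter> l) \<le> card {hpt u v w 0 c (- b), hpt u v w c 0 (- a), hpt u v w b (- a) 0}"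
      by (intro card_mono) simp_all
    also have "\<dots> \<le> 3" by (simp add: card_insert_if)
    finally show ?thesis by simp
  qed
qed

lemma tri_set_redei:
  assumes q: "CARD('a::{field,finite}) = 7" and f: "frame u v (w :: 'a ^ 3)"
  shows "redei_blocking_set (tri_set u v w)"
proof -
  let ?S = "tri_set u v w"
  have b: "blocking_set ?S" unfolding blocking_set_def
  proof (intro conjI ballI tri_set_subset_points[OF f])
    fix l :: "('a ^ 3) set set" assume "l \<in> pg_lines"
    then obtain a b c where abc: "a \<noteq> 0 \<or> b \<noteq> 0 \<or> c \<noteq> 0" "l = hline u v w a b c"
      by (rule pg_line_is_hline[OF f])
    show "?S \<inter> l \<noteq> {}" unfolding abc(2) by (rule tri_set_meets_line[OF f abc(1)])
    show "\<not> l \<subseteq> ?S" unfolding abc(2) by (rule tri_set_not_contains_line[OF f abc(1) field_7_facts(2,3)[OF q]])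
  qed
  have "minimal_blocking_set ?S" unfolding minimal_blocking_set_iff_tangents
    using b tri_set_tangent[OF f field_7_facts(2,3)[OF q]] by blast
  moreover have "Max ((\<lambda>l. card (?S \<inter> l)) ` pg_lines) = 6"
  proof (rule Max_eqI)
    show "finite ((\<lambda>l. card (?S \<inter> l)) ` pg_lines)" by simp
    show "k \<le> 6" if "k \<in> (\<lambda>l. card (?S \<inter> l)) ` pg_lines" for k
      using that card_tri_set_line[OF q f] by auto
    have "hline u v w 1 0 0 \<in> pg_lines" by (rule hline_in_lines[OF f]) simp
    then show "6 \<in> (\<lambda>l. card (?S \<inter> l)) ` pg_lines"
      using card_tri_set_axis_lines(1)[OF q f] by (intro image_eqI[of _ _ "hline u v w 1 0 0"]) simp_all
  qed
  ultimately show ?thesis unfolding redei_blocking_set_def using card_tri_set[OF q f] q by simp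
qed

lemma tri_set_index:
  assumes q: "CARD('a::{field,finite}) = 7" and f: "frame u v (w :: 'a ^ 3)"
  shows "pg_index (tri_set u v w) = 3"
  unfolding pg_index_def
proof (rule Least_equality)
  let ?l1 = "hline u v w 1 0 0" and ?l2 = "hline u v w 0 1 0" and ?l3 = "hline u v w 0 0 1"
  have V: "hpt u v w 1 0 0 \<notin> ?l1" "hpt u v w 1 0 0 \<in> ?l2" "hpt u v w 1 0 0 \<in> ?l3"
    "hpt u v w 0 1 0 \<notin> ?l2" "hpt u v w 0 1 0 \<in> ?l3"
    by (simp_all add: hpt_in_hline_iff[OF f])
  then have "?l1 \<noteq> ?l2" "?l1 \<noteq> ?l3" "?l2 \<noteq> ?l3" by metis+
  then have "card {?l1, ?l2, ?l3} = 3" by simp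
  moreover have "{?l1, ?l2, ?l3} \<subseteq> pg_lines" using hline_in_lines[OF f] by simp
  moreover have "tri_set u v w \<subseteq> \<Union> {?l1, ?l2, ?l3}" using tri_set_cover[of u v w] by (simp add: Un_assoc)
  ultimately show "\<exists>L. L \<subseteq> pg_lines \<and> card L = 3 \<and> tri_set u v w \<subseteq> \<Union> L"
    by (intro exI[of _ "{?l1, ?l2, ?l3}"] conjI)
next
  fix k assume "\<exists>L. L \<subseteq> pg_lines \<and> card L = k \<and> tri_set u v w \<subseteq> \<Union> L"
  then obtain L where L: "L \<subseteq> pg_lines" "card L = k" "tri_set u v w \<subseteq> \<Union> L" by blast
  have "tri_set u v w = (\<Union>l\<in>L. tri_set u v w \<inter> l)" using L(3) by (simp add: Int_Union[symmetric] inf.absorb1)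
  then have "13 = card (\<Union>l\<in>L. tri_set u v w \<inter> l)" using card_tri_set[OF q f] by simp
  also have "\<dots> \<le> (\<Sum>l\<in>L. card (tri_set u v w \<inter> l))" by (rule card_UN_le) simp
  also have "\<dots> \<le> (\<Sum>l\<in>L. 6)" using L(1) card_tri_set_line[OF q f] by (intro sum_mono) auto
  finally show "3 \<le> k" using L(2) by simp
qed

section \<open>Blocking sets on three concurrent lines\<close>

text \<open>
  The combinatorial content of being a Redei blocking set of size 13 in the plane of order 7.
\<close>

definition tight_blocking_set :: "('a::{field,finite} ^ 3) set set \<Rightarrow> bool" where
  "tight_blocking_set T \<longleftrightarrow> T \<subseteq> pg_points \<and> card T = 13 \<and>
     (\<forall>l\<in>pg_lines. T \<inter> l \<noteq> {} \<and> card (T \<inter> l) \<le> 6) \<and> (\<forall>P\<in>T. \<exists>l\<in>pg_lines. T \<inter> l = {P})"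

lemma redei_imp_tight:
  fixes T :: "('a::{field,finite} ^ 3) set set"
  assumes q: "CARD('a) = 7" and T: "redei_blocking_set T" "card T = 13"
  shows "tight_blocking_set T"
proof -
  have m: "blocking_set T \<and> (\<forall>P\<in>T. \<exists>l\<in>pg_lines. T \<inter> l = {P})"
    using T(1) unfolding redei_blocking_set_def minimal_blocking_set_iff_tangents by simp
  have M: "Max ((\<lambda>l. card (T \<inter> l)) ` pg_lines) = 6"
    using T q unfolding redei_blocking_set_def by auto
  have "card (T \<inter> l) \<le> 6" if "l \<in> pg_lines" for l
    unfolding M[symmetric] using that by (intro Max_ge) auto
  then show ?thesis using m T(2) unfolding tight_blocking_set_def blocking_set_def by simp
qed

text \<open>
  The common point $(0 : 0 : 1)$ is in \<open>T\<close>, because $x = y$ is a fourth line through it. The sets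
  \<open>X\<close>, \<open>Y\<close>, \<open>Z\<close> in the proof describe the points of \<open>T\<close> on the three lines.
\<close>

lemma concurrent_impossible:
  fixes u v w :: "'a::{field,finite} ^ 3"
  assumes q: "CARD('a) = 7" and f: "frame u v w" and T: "tight_blocking_set T"
    and cover: "T \<subseteq> hline u v w 1 0 0 \<union> hline u v w 0 1 0 \<union> hline u v w 1 1 0"
  shows False
proof -
  let ?h = "hpt u v w"
  have T1: "T \<subseteq> pg_points" "card T = 13" using T unfolding tight_blocking_set_def by simp_all
  have meets: "\<exists>x y z. (x \<noteq> 0 \<or> y \<noteq> 0 \<or> z \<noteq> 0) \<and> ?h x y z \<in> T \<and> a * x + b * y + c * z = 0
      \<and> (x = 0 \<or> y = 0 \<or> x + y = 0)" if "a \<noteq> 0 \<or> b \<noteq> 0 \<or> c \<noteq> 0" for a b c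
  proof -
    have "T \<inter> hline u v w a b c \<noteq> {}"
      using T hline_in_lines[OF f that] unfolding tight_blocking_set_def by simp
    then obtain P where P: "P \<in> T" "P \<in> hline u v w a b c" by auto
    then obtain x y z where xyz: "P = ?h x y z" "x \<noteq> 0 \<or> y \<noteq> 0 \<or> z \<noteq> 0" "a * x + b * y + c * z = 0"
      unfolding hline_def by auto
    have "x = 0 \<or> y = 0 \<or> x + y = 0"
      using cover P(1) xyz(1) hpt_in_hline_iff[OF f xyz(2)] by auto
    then show ?thesis using xyz P(1) by (intro exI[of _ x] exI[of _ y] exI[of _ z]) simp
  qed
  have le6: "card (T \<inter> hline u v w a b c) \<le> 6" if "a \<noteq> 0 \<or> b \<noteq> 0 \<or> c \<noteq> 0" for a b c
    using T hline_in_lines[OF f that] unfolding tight_blocking_set_def by simp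
  have two: "(2::'a) \<noteq> 0" using field_7_facts(2)[OF q] .
  define X where "X = {t. ?h 0 1 t \<in> T}"
  define Y where "Y = {t. ?h 1 0 t \<in> T}"
  define Z where "Z = {t. ?h 1 (- 1) t \<in> T}"
  have W: "?h 0 0 1 \<in> T"
  proof -
    obtain x y z where p: "x \<noteq> 0 \<or> y \<noteq> 0 \<or> z \<noteq> 0" "?h x y z \<in> T" "1 * x + (- 1) * y + 0 * z = 0"
      "x = 0 \<or> y = 0 \<or> x + y = 0" using meets[of 1 "- 1" 0] by auto
    have "x = y" using p(3) by simp
    moreover have "x = 0" using p(4) \<open>x = y\<close> two by (auto simp flip: mult_2)
    ultimately show ?thesis using p(1,2) hpt_scale[of z u v w 0 0 1] by simp
  qed
  have inj: "inj_on (\<lambda>t. ?h 0 1 t) A" "inj_on (\<lambda>t. ?h 1 0 t) A" "inj_on (\<lambda>t. ?h 1 (- 1) t) A" for A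
    by (rule inj_onI, simp add: hpt_eq_iff[OF f])+
  have notin: "?h 0 0 1 \<notin> (\<lambda>t. ?h 0 1 t) ` A" "?h 0 0 1 \<notin> (\<lambda>t. ?h 1 0 t) ` A"
     "?h 0 0 1 \<notin> (\<lambda>t. ?h 1 (- 1) t) ` A" for A
    by (auto simp: hpt_eq_iff[OF f])
  have dis: "(\<lambda>t. ?h 0 1 t) ` A \<inter> (\<lambda>t. ?h 1 0 t) ` B = {}" "(\<lambda>t. ?h 0 1 t) ` A \<inter> (\<lambda>t. ?h 1 (- 1) t) ` B = {}"
     "(\<lambda>t. ?h 1 0 t) ` A \<inter> (\<lambda>t. ?h 1 (- 1) t) ` B = {}" for A B
    by (auto simp: hpt_eq_iff[OF f])
  have lines: "insert (?h 0 0 1) ((\<lambda>t. ?h 0 1 t) ` X) \<subseteq> T \<inter> hline u v w 1 0 0"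
    "insert (?h 0 0 1) ((\<lambda>t. ?h 1 0 t) ` Y) \<subseteq> T \<inter> hline u v w 0 1 0"
    "insert (?h 0 0 1) ((\<lambda>t. ?h 1 (- 1) t) ` Z) \<subseteq> T \<inter> hline u v w 1 1 0"
    using W by (auto simp: X_def Y_def Z_def intro!: hpt_in_hline)
  have "Suc (card X) \<le> 6"
    using order_trans[OF card_mono[OF _ lines(1)] le6] notin(1)[of X] by (simp add: card_image[OF inj(1)])
  moreover have "Suc (card Y) \<le> 6"
    using order_trans[OF card_mono[OF _ lines(2)] le6] notin(2)[of Y] by (simp add: card_image[OF inj(2)])
  moreover have "Suc (card Z) \<le> 6"
    using order_trans[OF card_mono[OF _ lines(3)] le6] notin(3)[of Z] by (simp add: card_image[OF inj(3)])
  moreover have "card X + card Y + card Z = 12"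
  proof -
    let ?U = "(\<lambda>t. ?h 0 1 t) ` X \<union> (\<lambda>t. ?h 1 0 t) ` Y \<union> (\<lambda>t. ?h 1 (- 1) t) ` Z"
    have "P \<in> insert (?h 0 0 1) ?U" if P: "P \<in> T" for P
    proof -
      have "P \<in> pg_points" using T1(1) P by (rule subsetD)
      then obtain x y z where xyz: "x \<noteq> 0 \<or> y \<noteq> 0 \<or> z \<noteq> 0" "P = ?h x y z" by (rule pg_points_hpt[OF f])
      have c: "x = 0 \<or> y = 0 \<or> x + y = 0"
        using cover P xyz(2) hpt_in_hline_iff[OF f xyz(1)] by auto
      consider "x = 0" "y = 0" | "x = 0" "y \<noteq> 0" | "x \<noteq> 0" "y = 0" | "x \<noteq> 0" "y = - x"
        using c by (auto simp: eq_neg_iff_add_eq_0 add.commute)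
      then show ?thesis
      proof cases
        case 1 then show ?thesis using xyz hpt_scale[of z u v w 0 0 1] by simp
      next
        case 2
        then have e: "P = ?h 0 1 (z / y)" using xyz hpt_scale[of y u v w 0 1 "z / y"] by simp
        then have "z / y \<in> X" using P by (simp add: X_def)
        then show ?thesis using e by simp
      next
        case 3
        then have e: "P = ?h 1 0 (z / x)" using xyz hpt_scale[of x u v w 1 0 "z / x"] by simp
        then have "z / x \<in> Y" using P by (simp add: Y_def)
        then show ?thesis using e by simp
      next
        case 4
        then have e: "P = ?h 1 (- 1) (z / x)" using xyz hpt_scale[of x u v w 1 "- 1" "z / x"] by simp
        then have "z / x \<in> Z" using P by (simp add: Z_def)
        then show ?thesis using e by simp
      qed
    qed
    then have "T \<subseteq> insert (?h 0 0 1) ?U" by (rule subsetI)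
    moreover have "insert (?h 0 0 1) ?U \<subseteq> T" using W by (auto simp: X_def Y_def Z_def)
    ultimately have "T = insert (?h 0 0 1) ?U" by (rule subset_antisym)
    then have "13 = card (insert (?h 0 0 1) ?U)" using T1(2) by simp
    also have "\<dots> = Suc (card ?U)" using notin by simp
    also have "card ?U = card X + card Y + card Z"
      using dis(1)[of X Y] dis(2)[of X Z] dis(3)[of Y Z]
      by (simp add: card_Un_disjoint Int_Un_distrib2 card_image[OF inj(1)] card_image[OF inj(2)] card_image[OF inj(3)])
    finally show ?thesis by simp
  qed
  ultimately have bounds: "card X \<le> 5" "card Y \<le> 5" "card Z \<le> 5" "card X + card Y + card Z = 12" by simp_all
  define A where "A = uminus ` (- X)"
  define B where "B = - Y"
  have cA: "card A = 7 - card X" unfolding A_def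
    by (subst card_image) (simp_all add: q Compl_eq_Diff_UNIV card_Diff_subset)
  have cB: "card B = 7 - card Y" unfolding B_def by (simp add: q Compl_eq_Diff_UNIV card_Diff_subset)
  have sum: "{a + b | a b. a \<in> A \<and> b \<in> B} \<subseteq> Z"
  proof
    fix s assume "s \<in> {a + b | a b. a \<in> A \<and> b \<in> B}"
    then obtain t b where tb: "t \<notin> X" "b \<notin> Y" "s = b - t" unfolding A_def B_def by auto
    \<comment> \<open>the line $z = b x + t y$ meets the three lines in $(0 : 1 : t)$, $(1 : 0 : b)$ and $(1 : -1 : s)$\<close>
    obtain x y z where p: "x \<noteq> 0 \<or> y \<noteq> 0 \<or> z \<noteq> 0" "?h x y z \<in> T" "b * x + t * y + (- 1) * z = 0"
      "x = 0 \<or> y = 0 \<or> x + y = 0" using meets[of b t "- 1"] by auto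
    have z: "z = b * x + t * y" using p(3) by simp
    have "x \<noteq> 0"
    proof
      assume "x = 0"
      then have "?h 0 1 t \<in> T" using p(1,2) z hpt_scale[of y u v w 0 1 t] by (simp add: mult.commute)
      then show False using tb(1) X_def by simp
    qed
    moreover have "y \<noteq> 0"
    proof
      assume "y = 0"
      then have "?h 1 0 b \<in> T" using p(1,2) z hpt_scale[of x u v w 1 0 b] by (simp add: mult.commute)
      then show False using tb(2) Y_def by simp
    qed
    ultimately have y: "y = - x" using p(4) by (simp add: eq_neg_iff_add_eq_0 add.commute)
    then have "z = x * (b - t)" using z by (simp add: algebra_simps)
    then have "?h 1 (- 1) s \<in> T" using p(2) y tb(3) \<open>x \<noteq> 0\<close> hpt_scale[of x u v w 1 "- 1" "b - t"] by simp
    then show "s \<in> Z" by (simp add: Z_def)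
  qed
  have "A \<noteq> {}" "B \<noteq> {}" using cA cB bounds by auto
  then have "min CARD('a) (card A + card B - 1) \<le> card {a + b | a b. a \<in> A \<and> b \<in> B}"
    by (rule cauchy_davenport[OF field_7_facts(1)[OF q]])
  also have "\<dots> \<le> card Z" using sum by (intro card_mono) simp_all
  finally show False using cA cB bounds q by simp
qed

section \<open>Blocking sets on the sides of a triangle: classification\<close>

text \<open>
  \<open>T\<close> lies on the sides of the triangle with vertices spanned by \<open>u\<close>, \<open>v\<close>, \<open>w\<close>.
\<close>

definition triangle_cover :: "('a::{field,finite} ^ 3) set set \<Rightarrow> 'a ^ 3 \<Rightarrow> 'a ^ 3 \<Rightarrow> 'a ^ 3 \<Rightarrow> bool" where
  "triangle_cover T u v w \<longleftrightarrow> frame u v w \<and> tight_blocking_set T \<and>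
     T \<subseteq> hline u v w 1 0 0 \<union> hline u v w 0 1 0 \<union> hline u v w 0 0 1"

text \<open>
  The parameters of the points of the side $x = 0$ that are not in \<open>T\<close>.
\<close>

definition gap :: "('a::{field,finite} ^ 3) set set \<Rightarrow> 'a ^ 3 \<Rightarrow> 'a ^ 3 \<Rightarrow> 'a ^ 3 \<Rightarrow> 'a set" where
  "gap T u v w = {a. a \<noteq> 0 \<and> hpt u v w 0 1 (- a) \<notin> T}"

lemma zero_notin_gap [simp]: "0 \<notin> gap T u v w"
  by (simp add: gap_def)

lemma gap_rotate:
  "gap T v w u = {b. b \<noteq> 0 \<and> hpt u v w (- b) 0 1 \<notin> T}"
  "gap T w u v = {c. c \<noteq> 0 \<and> hpt u v w 1 (- c) 0 \<notin> T}"
  using hpt_rotate[where u = u and v = v and w = w and y = 0 and z = 1]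
    hpt_rotate[where u = v and v = w and w = u and y = 0 and z = 1]
    hpt_rotate[where u = u and v = v and w = w and x = 1 and z = 0]
  by (simp_all add: gap_def)

lemma card_on_side:
  fixes u :: "'a::{field,finite} ^ 3"
  assumes q: "CARD('a) = 7"
  shows "card (on_side T u v w) + card (gap T u v w) = 6"
proof -
  have "on_side T u v w \<union> gap T u v w = UNIV - {0}" by (auto simp: on_side_def gap_def)
  moreover have "on_side T u v w \<inter> gap T u v w = {}" by (auto simp: on_side_def gap_def)
  moreover have "card (UNIV - {0::'a}) = 6" using q by (simp add: card_Diff_subset)
  ultimately show ?thesis by (metis card_Un_disjoint finite)
qed

lemma triangle_cover_rotate:
  assumes "triangle_cover T u v w" shows "triangle_cover T v w u"
proof -
  have "hline v w u 1 0 0 = hline u v w 0 1 0" "hline v w u 0 1 0 = hline u v w 0 0 1"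
    "hline v w u 0 0 1 = hline u v w 1 0 0"
    by (rule hline_rotate)+
  then show ?thesis using assms frame_rotate unfolding triangle_cover_def by auto
qed

lemma triangle_cover_meets:
  assumes T: "triangle_cover T u v w" and abc: "a \<noteq> 0 \<or> b \<noteq> 0 \<or> c \<noteq> 0"
  obtains x y z where "x \<noteq> 0 \<or> y \<noteq> 0 \<or> z \<noteq> 0" "hpt u v w x y z \<in> T" "a * x + b * y + c * z = 0"
    "x = 0 \<or> y = 0 \<or> z = 0"
proof -
  have f: "frame u v w" and cover: "T \<subseteq> hline u v w 1 0 0 \<union> hline u v w 0 1 0 \<union> hline u v w 0 0 1"
    using T unfolding triangle_cover_def by simp_all
  have "T \<inter> hline u v w a b c \<noteq> {}"
    using T hline_in_lines[OF f abc] unfolding triangle_cover_def tight_blocking_set_def by simp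
  then obtain P where P: "P \<in> T" "P \<in> hline u v w a b c" by auto
  then obtain x y z where xyz: "P = hpt u v w x y z" "x \<noteq> 0 \<or> y \<noteq> 0 \<or> z \<noteq> 0" "a * x + b * y + c * z = 0"
    unfolding hline_def by auto
  have "x = 0 \<or> y = 0 \<or> z = 0"
    using cover P(1) xyz(1) hpt_in_hline_iff[OF f xyz(2)] by auto
  then show thesis using xyz P(1) by (intro that) simp_all
qed

text \<open>
  The lines joining a missing vertex to the points of the opposite side can be blocked only on
  that side.
\<close>

lemma vertex_missing_gap_empty:
  assumes T: "triangle_cover T u v w" and "hpt u v w 1 0 0 \<notin> T"
  shows "gap T u v w = {}"
proof -
  have "hpt u v w 0 1 (- a) \<in> T" if a: "a \<noteq> 0" for a
  proof -
    obtain x y z where p: "x \<noteq> 0 \<or> y \<noteq> 0 \<or> z \<noteq> 0" "hpt u v w x y z \<in> T" "0 * x + a * y + 1 * z = 0"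
      "x = 0 \<or> y = 0 \<or> z = 0" by (rule triangle_cover_meets[OF T, of 0 a 1]) simp_all
    have z: "z = y * - a" using p(3) by (simp add: eq_neg_iff_add_eq_0 algebra_simps)
    have "y \<noteq> 0"
    proof
      assume "y = 0"
      then show False using z p(1,2) assms(2) hpt_scale[of x u v w 1 0 0] by simp
    qed
    then have "x = 0" using p(4) z a by simp
    then show ?thesis using p(2) z \<open>y \<noteq> 0\<close> hpt_scale[of y u v w 0 1 "- a"] by simp
  qed
  then show ?thesis by (auto simp: gap_def)
qed

lemma triangle_cover_line:
  fixes u v w :: "'a::{field,finite} ^ 3"
  assumes q: "CARD('a) = 7" and T: "triangle_cover T u v w"
  shows "card (T \<inter> {hpt u v w 0 1 0, hpt u v w 0 0 1}) \<le> card (gap T u v w)"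
proof -
  have f: "frame u v w" and S: "T \<subseteq> pg_points"
    using T unfolding triangle_cover_def tight_blocking_set_def by simp_all
  have "hline u v w 1 0 0 \<in> pg_lines" by (rule hline_in_lines[OF f]) simp
  then have "card (T \<inter> hline u v w 1 0 0) \<le> 6"
    using T unfolding triangle_cover_def tight_blocking_set_def by simp
  then show ?thesis using card_side_line[OF f S] card_on_side[OF q, of T u v w] by simp
qed

lemma gap_empty_vertices_missing:
  fixes u v w :: "'a::{field,finite} ^ 3"
  assumes q: "CARD('a) = 7" and T: "triangle_cover T u v w" and "gap T u v w = {}"
  shows "hpt u v w 0 1 0 \<notin> T" "hpt u v w 0 0 1 \<notin> T"
proof -
  have "T \<inter> {hpt u v w 0 1 0, hpt u v w 0 0 1} = {}"
    using triangle_cover_line[OF q T] assms(3) by simp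
  then show "hpt u v w 0 1 0 \<notin> T" "hpt u v w 0 0 1 \<notin> T" by auto
qed

lemma triangle_cover_card:
  fixes u v w :: "'a::{field,finite} ^ 3"
  assumes q: "CARD('a) = 7" and T: "triangle_cover T u v w"
  shows "card (gap T u v w) + card (gap T v w u) + card (gap T w u v) =
    5 + card (T \<inter> {hpt u v w 1 0 0, hpt u v w 0 1 0, hpt u v w 0 0 1})"
proof -
  have f: "frame u v w" and S: "T \<subseteq> pg_points" "card T = 13"
    and cover: "T \<subseteq> hline u v w 1 0 0 \<union> hline u v w 0 1 0 \<union> hline u v w 0 0 1"
    using T unfolding triangle_cover_def tight_blocking_set_def by simp_all
  show ?thesis using card_triangle[OF f S(1) cover] S(2)
      card_on_side[OF q, of T u v w] card_on_side[OF q, of T v w u] card_on_side[OF q, of T w u v] by simp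
qed

text \<open>
  If one vertex were missing, its opposite side would contain six points of \<open>T\<close> already, so the other
  vertices would be missing as well, and \<open>T\<close> would have 18 points.
\<close>

lemma triangle_cover_vertex:
  fixes u v w :: "'a::{field,finite} ^ 3"
  assumes q: "CARD('a) = 7" and T: "triangle_cover T u v w"
  shows "hpt u v w 1 0 0 \<in> T"
proof (rule ccontr)
  assume n: "hpt u v w 1 0 0 \<notin> T"
  note T' = triangle_cover_rotate[OF T] and T'' = triangle_cover_rotate[OF triangle_cover_rotate[OF T]]
  have g: "gap T u v w = {}" by (rule vertex_missing_gap_empty[OF T n])
  note m = gap_empty_vertices_missing[OF q T g]
  have "gap T v w u = {}"
    using m(1) hpt_rotate[of v w u 0 0 1] hpt_rotate[of v w u 1 0 0] by (intro vertex_missing_gap_empty[OF T']) simp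
  moreover have "gap T w u v = {}"
    using m(2) hpt_rotate[of w u v 1 0 0] hpt_rotate[of v w u 0 1 0] by (intro vertex_missing_gap_empty[OF T'']) simp
  ultimately show False using triangle_cover_card[OF q T] g by simp
qed

lemma triangle_cover_vertices:
  fixes u v w :: "'a::{field,finite} ^ 3"
  assumes q: "CARD('a) = 7" and T: "triangle_cover T u v w"
  shows "hpt u v w 1 0 0 \<in> T" "hpt u v w 0 1 0 \<in> T" "hpt u v w 0 0 1 \<in> T"
  using triangle_cover_vertex[OF q T] triangle_cover_vertex[OF q triangle_cover_rotate[OF T]]
    triangle_cover_vertex[OF q triangle_cover_rotate[OF triangle_cover_rotate[OF T]]]
    hpt_rotate[of v w u 1 0 0] hpt_rotate[of w u v 1 0 0] hpt_rotate[of v w u 0 1 0] by simp_all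

lemma card_gap_ge_2:
  fixes u v w :: "'a::{field,finite} ^ 3"
  assumes q: "CARD('a) = 7" and T: "triangle_cover T u v w"
  shows "card (gap T u v w) \<ge> 2"
proof -
  have f: "frame u v w" using T unfolding triangle_cover_def by simp
  have "T \<inter> {hpt u v w 0 1 0, hpt u v w 0 0 1} = {hpt u v w 0 1 0, hpt u v w 0 0 1}"
    using triangle_cover_vertices[OF q T] by (intro Int_absorb1) simp
  then show ?thesis using triangle_cover_line[OF q T] vertices_distinct[OF f] by simp
qed

lemma sum_card_gap:
  fixes u v w :: "'a::{field,finite} ^ 3"
  assumes q: "CARD('a) = 7" and T: "triangle_cover T u v w"
  shows "card (gap T u v w) + card (gap T v w u) + card (gap T w u v) = 8"
proof -
  have f: "frame u v w" using T unfolding triangle_cover_def by simp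
  have "T \<inter> {hpt u v w 1 0 0, hpt u v w 0 1 0, hpt u v w 0 0 1} = {hpt u v w 1 0 0, hpt u v w 0 1 0, hpt u v w 0 0 1}"
    using triangle_cover_vertices[OF q T] by (intro Int_absorb1) simp
  then show ?thesis using triangle_cover_card[OF q T] vertices_distinct[OF f] by simp
qed

text \<open>
  The line $x + a b y + b z = 0$ meets the sides in the points with parameters \<open>a\<close>, \<open>b\<close> and
  $1 / (a b)$.
\<close>

lemma gap_product:
  assumes T: "triangle_cover T u v w" and abc: "a \<in> gap T u v w" "b \<in> gap T v w u" "c \<in> gap T w u v"
  shows "a * b * c \<noteq> 1"
proof
  assume e: "a * b * c = 1"
  have n: "a \<noteq> 0" "b \<noteq> 0" "c \<noteq> 0" "hpt u v w 0 1 (- a) \<notin> T" "hpt u v w (- b) 0 1 \<notin> T" "hpt u v w 1 (- c) 0 \<notin> T"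
    using abc(1) abc(2)[unfolded gap_rotate(1)[of T v w u]] abc(3)[unfolded gap_rotate(2)[of T w u v]]
    by (simp_all add: gap_def[of T u v w])
  obtain x y z where p: "x \<noteq> 0 \<or> y \<noteq> 0 \<or> z \<noteq> 0" "hpt u v w x y z \<in> T" "1 * x + (a * b) * y + b * z = 0"
    "x = 0 \<or> y = 0 \<or> z = 0" by (rule triangle_cover_meets[OF T, of 1 "a * b" b]) simp_all
  from p(4) show False
  proof (elim disjE)
    assume x: "x = 0"
    then have "b * (a * y + z) = 0" using p(3) by (simp add: algebra_simps)
    then have "a * y + z = 0" using n(2) by simp
    then have z: "z = y * - a" by (simp add: eq_neg_iff_add_eq_0 add.commute mult.commute)
    then have "y \<noteq> 0" using p(1) x by auto
    then show False using p(2) x z n(4) hpt_scale[of y u v w 0 1 "- a"] by simp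
  next
    assume y: "y = 0"
    then have x: "x = z * - b" using p(3) by (simp add: eq_neg_iff_add_eq_0 algebra_simps)
    then have "z \<noteq> 0" using p(1) y by auto
    then show False using p(2) x y n(5) hpt_scale[of z u v w "- b" 0 1] by simp
  next
    assume z: "z = 0"
    then have "x + a * b * y = 0" using p(3) by simp
    then have "c * (x + a * b * y) = 0" by simp
    then have "c * x + (a * b * c) * y = 0" by (simp add: algebra_simps)
    then have "c * x + y = 0" by (simp add: e)
    then have y: "y = x * - c" by (simp add: eq_neg_iff_add_eq_0 add.commute mult.commute)
    then have "x \<noteq> 0" using p(1) z by auto
    then show False using p(2) y z n(6) hpt_scale[of x u v w 1 "- c" 0] by simp
  qed
qed

text \<open>
  A tangent to \<open>T\<close> at the point with parameter \<open>a\<close> passes through no vertex, and meets the other two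
  sides in points that are not in \<open>T\<close>.
\<close>

lemma gap_maximal:
  fixes u v w :: "'a::{field,finite} ^ 3"
  assumes q: "CARD('a) = 7" and T: "triangle_cover T u v w" and a: "a \<noteq> 0" "a \<notin> gap T u v w"
  shows "\<exists>b\<in>gap T v w u. \<exists>c\<in>gap T w u v. a * b * c = 1"
proof -
  have f: "frame u v w" using T unfolding triangle_cover_def by simp
  let ?P = "hpt u v w 0 1 (- a)"
  have P: "?P \<in> T" using a by (simp add: gap_def)
  then have "\<exists>l\<in>pg_lines. T \<inter> l = {?P}"
    using T unfolding triangle_cover_def tight_blocking_set_def by simp
  then obtain l where l: "l \<in> pg_lines" "T \<inter> l = {?P}" by (elim bexE)
  obtain r s t where l_eq: "l = hline u v w r s t" using l(1) by (rule pg_line_is_hline[OF f])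
  have "?P \<in> l" using l(2) by (metis IntD2 singletonI)
  then have s: "s = a * t" unfolding l_eq by (simp add: hpt_in_hline_iff[OF f] algebra_simps)
  have notin: "hpt u v w x y z \<notin> T" if "x \<noteq> 0 \<or> y \<noteq> 0 \<or> z \<noteq> 0" "hpt u v w x y z \<noteq> ?P" "r * x + s * y + t * z = 0" for x y z
  proof
    assume "hpt u v w x y z \<in> T"
    moreover have "hpt u v w x y z \<in> l" unfolding l_eq using that(1,3) by (rule hpt_in_hline)
    ultimately have "hpt u v w x y z \<in> {?P}" unfolding l(2)[symmetric] by (rule IntI)
    then show False using that(2) by simp
  qed
  note V = triangle_cover_vertices[OF q T]
  have r: "r \<noteq> 0" using notin[of 1 0 0] V(1) by (auto simp: hpt_eq_iff[OF f])
  have t: "t \<noteq> 0" using notin[of 0 0 1] V(3) by (auto simp: hpt_eq_iff[OF f])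
  have s0: "s \<noteq> 0" using s t a by simp
  have "t / r \<in> gap T v w u" unfolding gap_rotate(1)[of T v w u]
    using r t notin[of "- (t / r)" 0 1] by (simp add: hpt_eq_iff[OF f])
  moreover have "r / s \<in> gap T w u v" unfolding gap_rotate(2)[of T w u v]
    using r s0 notin[of 1 "- (r / s)" 0] a(1) by (simp add: hpt_eq_iff[OF f])
  moreover have "a * (t / r) * (r / s) = 1" using r t a(1) s by simp
  ultimately show ?thesis by (intro bexI)
qed

lemma mult_in_pm_iff:
  fixes a t :: "'a::field"
  assumes "a \<noteq> 0" shows "a * t \<in> {a, - a} \<longleftrightarrow> t\<^sup>2 = 1"
proof -
  have "a * t = - a \<longleftrightarrow> t = - 1" using assms by (metis mult_cancel_left mult_minus1_right)
  then show ?thesis using assms by (simp add: power2_eq_1_iff)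
qed

text \<open>
  The coordinate vectors are rescaled so that \<open>a\<close> and \<open>b\<close> become 1.
\<close>

lemma tri_set_of_gaps:
  fixes u v w :: "'a::{field,finite} ^ 3"
  assumes q: "CARD('a) = 7" and T: "triangle_cover T u v w" and ab: "a \<noteq> 0" "b \<noteq> 0"
    and gaps: "gap T u v w = {a, - a}" "gap T v w u = {b, - b}" "gap T w u v = {c. c \<noteq> 0 \<and> (a * b * c)\<^sup>2 \<noteq> 1}"
  shows "frame ((a * b) *s u) v (a *s w) \<and> T = tri_set ((a * b) *s u) v (a *s w)"
proof
  have f: "frame u v w" and S: "T \<subseteq> pg_points"
    and cover: "T \<subseteq> hline u v w 1 0 0 \<union> hline u v w 0 1 0 \<union> hline u v w 0 0 1"
    using T unfolding triangle_cover_def tight_blocking_set_def by simp_all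
  show f': "frame ((a * b) *s u) v (a *s w)" unfolding frame_def
  proof (intro allI impI)
    fix x y z assume "x *s ((a * b) *s u) + y *s v + z *s (a *s w) = 0"
    then have "(x * (a * b)) *s u + y *s v + (z * a) *s w = 0" by simp
    then have "x * (a * b) = 0 \<and> y = 0 \<and> z * a = 0" using f unfolding frame_def by blast
    then show "x = 0 \<and> y = 0 \<and> z = 0" using ab by simp
  qed
  have change: "hpt ((a * b) *s u) v (a *s w) x y z = hpt u v w (a * b * x) y (a * z)" for x y z
    by (simp add: hpt_def mult.commute)
  note V = triangle_cover_vertices[OF q T]
  have in_T: "hpt u v w (a * b * x) y (a * z) \<in> T \<longleftrightarrow> tri_zero x y z" if nz: "x \<noteq> 0 \<or> y \<noteq> 0 \<or> z \<noteq> 0" for x y z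
  proof -
    consider "x = 0" "y = 0" "z \<noteq> 0" | "x = 0" "y \<noteq> 0" "z = 0" | "x \<noteq> 0" "y = 0" "z = 0"
      | "x = 0" "y \<noteq> 0" "z \<noteq> 0" | "x \<noteq> 0" "y = 0" "z \<noteq> 0" | "x \<noteq> 0" "y \<noteq> 0" "z = 0"
      | "x \<noteq> 0" "y \<noteq> 0" "z \<noteq> 0" using nz by blast
    then show ?thesis
    proof cases
      case 1
      then show ?thesis using V(3) ab hpt_scale[of "a * z" u v w 0 0 1] by (simp add: tri_zero_def)
    next
      case 2
      then show ?thesis using V(2) hpt_scale[of y u v w 0 1 0] by (simp add: tri_zero_def)
    next
      case 3
      then show ?thesis using V(1) ab hpt_scale[of "a * b * x" u v w 1 0 0] by (simp add: tri_zero_def)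
    next
      case 4
      have e: "hpt u v w (a * b * x) y (a * z) = hpt u v w 0 1 (- (- (a * z / y)))"
        using 4 hpt_scale[of y u v w 0 1 "a * z / y"] by simp
      have "hpt u v w (a * b * x) y (a * z) \<in> T \<longleftrightarrow> - (a * z / y) \<notin> gap T u v w"
        unfolding e gap_def using 4 ab by simp
      also have "\<dots> \<longleftrightarrow> (- (z / y))\<^sup>2 \<noteq> 1" unfolding gaps using mult_in_pm_iff[OF ab(1), of "- (z / y)"] by simp
      also have "\<dots> \<longleftrightarrow> y\<^sup>2 \<noteq> z\<^sup>2" using 4 by (auto simp: power_divide)
      finally show ?thesis using 4 by (simp add: tri_zero_def)
    next
      case 5
      have e: "hpt u v w (a * b * x) y (a * z) = hpt u v w (- (- (b * x / z))) 0 1"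
        using 5 ab hpt_scale[of "a * z" u v w "b * x / z" 0 1] by (simp add: mult.assoc)
      have "hpt u v w (a * b * x) y (a * z) \<in> T \<longleftrightarrow> - (b * x / z) \<notin> gap T v w u"
        unfolding e gap_rotate(1)[of T v w u] using 5 ab by simp
      also have "\<dots> \<longleftrightarrow> (- (x / z))\<^sup>2 \<noteq> 1" unfolding gaps using mult_in_pm_iff[OF ab(2), of "- (x / z)"] by simp
      also have "\<dots> \<longleftrightarrow> x\<^sup>2 \<noteq> z\<^sup>2" using 5 by (auto simp: power_divide)
      finally show ?thesis using 5 by (simp add: tri_zero_def)
    next
      case 6
      have e: "hpt u v w (a * b * x) y (a * z) = hpt u v w 1 (- (- (y / (a * b * x)))) 0"
        using 6 ab hpt_scale[of "a * b * x" u v w 1 "y / (a * b * x)" 0] by simp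
      have "hpt u v w (a * b * x) y (a * z) \<in> T \<longleftrightarrow> - (y / (a * b * x)) \<notin> gap T w u v"
        unfolding e gap_rotate(2)[of T w u v] using 6 ab by simp
      also have "\<dots> \<longleftrightarrow> (a * b * - (y / (a * b * x)))\<^sup>2 = 1" unfolding gaps using 6 ab by simp
      also have "a * b * - (y / (a * b * x)) = - (y / x)" using ab by simp
      also have "(- (y / x))\<^sup>2 = 1 \<longleftrightarrow> x\<^sup>2 = y\<^sup>2" using 6 by (auto simp: power_divide)
      finally show ?thesis using 6 by (simp add: tri_zero_def)
    next
      case 7
      then have n: "a * b * x \<noteq> 0 \<or> y \<noteq> 0 \<or> a * z \<noteq> 0" by simp
      have "hpt u v w (a * b * x) y (a * z) \<notin> T"
      proof
        assume "hpt u v w (a * b * x) y (a * z) \<in> T"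
        then have "hpt u v w (a * b * x) y (a * z) \<in> hline u v w 1 0 0 \<union> hline u v w 0 1 0 \<union> hline u v w 0 0 1"
          using cover by (rule set_mp[rotated])
        then show False using 7 ab by (simp add: hpt_in_hline_iff[OF f n])
      qed
      then show ?thesis using 7 by (simp add: tri_zero_def)
    qed
  qed
  have iff: "P \<in> T \<longleftrightarrow> P \<in> tri_set ((a * b) *s u) v (a *s w)" if P: "P \<in> pg_points" for P
  proof -
    obtain x y z where xyz: "x \<noteq> 0 \<or> y \<noteq> 0 \<or> z \<noteq> 0" "P = hpt ((a * b) *s u) v (a *s w) x y z"
      using P by (rule pg_points_hpt[OF f'])
    show ?thesis unfolding xyz(2) hpt_in_tri_set_iff[OF f' xyz(1)] unfolding change by (rule in_T[OF xyz(1)])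
  qed
  show "T = tri_set ((a * b) *s u) v (a *s w)"
  proof (rule subset_antisym)
    show "T \<subseteq> tri_set ((a * b) *s u) v (a *s w)" using S iff by auto
    show "tri_set ((a * b) *s u) v (a *s w) \<subseteq> T" using tri_set_subset_points[OF f'] iff by auto
  qed
qed

lemma triangle_cover_classification_ordered:
  fixes u v w :: "'a::{field,finite} ^ 3"
  assumes q: "CARD('a) = 7" and T: "triangle_cover T u v w"
  shows "card (gap T u v w) = 2 \<Longrightarrow> card (gap T v w u) = 2 \<Longrightarrow>
      \<exists>u' v' w'. frame u' v' w' \<and> T = tri_set u' v' w'"
    and "card (gap T u v w) = 2 \<Longrightarrow> card (gap T v w u) = 3 \<Longrightarrow> False"
proof -
  note sum = sum_card_gap[OF q T]
  assume 2: "card (gap T u v w) = 2" "card (gap T v w u) = 2"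
  then have 4: "card (gap T w u v) = 4" using sum by simp
  obtain a b where ab: "a \<noteq> 0" "b \<noteq> 0" "gap T u v w = {a, - a}" "gap T v w u = {b, - b}"
    "gap T w u v = {c. c \<noteq> 0 \<and> (a * b * c)\<^sup>2 \<noteq> 1}"
    by (rule product_avoiding_2_2_4[OF q zero_notin_gap zero_notin_gap zero_notin_gap gap_product[OF T] 2 4])
  show "\<exists>u' v' w'. frame u' v' w' \<and> T = tri_set u' v' w'"
    by (intro exI) (rule tri_set_of_gaps[OF q T ab])
next
  note sum = sum_card_gap[OF q T]
  assume 23: "card (gap T u v w) = 2" "card (gap T v w u) = 3"
  then have 3: "card (gap T w u v) = 3" using sum by simp
  show False
    by (rule product_avoiding_2_3_3[OF q zero_notin_gap zero_notin_gap zero_notin_gap gap_product[OF T] gap_maximal[OF q T] 23 3])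
qed

lemma triangle_cover_classification:
  fixes u v w :: "'a::{field,finite} ^ 3"
  assumes q: "CARD('a) = 7" and T: "triangle_cover T u v w"
  shows "\<exists>u' v' w'. frame u' v' w' \<and> T = tri_set u' v' w'"
proof -
  note T' = triangle_cover_rotate[OF T]
  note T'' = triangle_cover_rotate[OF T']
  note c = triangle_cover_classification_ordered[OF q T] triangle_cover_classification_ordered[OF q T']
    triangle_cover_classification_ordered[OF q T'']
  have "card (gap T u v w) \<ge> 2" "card (gap T v w u) \<ge> 2" "card (gap T w u v) \<ge> 2"
    using card_gap_ge_2[OF q T] card_gap_ge_2[OF q T'] card_gap_ge_2[OF q T''] by simp_all
  moreover note sum_card_gap[OF q T]
  ultimately consider "card (gap T u v w) = 2" "card (gap T v w u) = 2"
    | "card (gap T v w u) = 2" "card (gap T w u v) = 2" | "card (gap T w u v) = 2" "card (gap T u v w) = 2"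
    | "card (gap T u v w) = 2" "card (gap T v w u) = 3" | "card (gap T v w u) = 2" "card (gap T w u v) = 3"
    | "card (gap T w u v) = 2" "card (gap T u v w) = 3" by linarith
  then show ?thesis
  proof cases
    case 1 then show ?thesis by (rule c(1))
  next
    case 2 then show ?thesis by (rule c(3))
  next
    case 3 then show ?thesis by (rule c(5))
  next
    case 4 then show ?thesis using c(2) by simp
  next
    case 5 then show ?thesis using c(4) by simp
  next
    case 6 then show ?thesis using c(6) by simp
  qed
qed

theorem mainTheorem4:
  assumes "CARD('a::{field,finite}) = 7"
  shows "\<exists>S :: ('a ^ 3) set set.
           (redei_blocking_set S \<and> pg_index S = 3 \<and> card S = 13) \<and>
           (\<forall>T :: ('a ^ 3) set set.
              redei_blocking_set T \<and> pg_index T = 3 \<and> card T = 13 \<longrightarrow> proj_equivalent S T)"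
proof -
  let ?e1 = "axis 1 1 :: 'a ^ 3" and ?e2 = "axis 2 1 :: 'a ^ 3" and ?e3 = "axis 3 1 :: 'a ^ 3"
  let ?S = "tri_set ?e1 ?e2 ?e3"
  have "proj_equivalent ?S T" if T: "redei_blocking_set T" "pg_index T = 3" "card T = 13" for T :: "('a ^ 3) set set"
  proof -
    have t: "tight_blocking_set T" by (rule redei_imp_tight[OF assms T(1,3)])
    then have "T \<subseteq> pg_points" unfolding tight_blocking_set_def by simp
    then obtain L where L: "L \<subseteq> pg_lines" "card L = pg_index T" "T \<subseteq> \<Union> L" by (rule pg_index_cover)
    then obtain l1 l2 l3 where l: "L = {l1, l2, l3}" "l1 \<noteq> l2" "l1 \<noteq> l3" "l2 \<noteq> l3"
      using T(2) by (metis card_3_iff)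
    have lines: "l1 \<in> pg_lines" "l2 \<in> pg_lines" "l3 \<in> pg_lines" using L(1) l(1) by simp_all
    obtain u v w where f: "frame u v w" and l12: "l1 = hline u v w 1 0 0" "l2 = hline u v w 0 1 0"
      and l3: "l3 = hline u v w 0 0 1 \<or> l3 = hline u v w 1 1 0"
      using lines l(2-4) by (rule three_lines_frame)
    have cover: "T \<subseteq> l1 \<union> l2 \<union> l3" using L(3) l(1) by (simp add: Un_assoc)
    have "l3 \<noteq> hline u v w 1 1 0"
      using concurrent_impossible[OF assms f t] cover l12 by auto
    then have "l3 = hline u v w 0 0 1" using l3 by simp
    then have "triangle_cover T u v w" unfolding triangle_cover_def using f t cover l12 by simp
    then obtain u' v' w' where f': "frame u' v' w'" and T_eq: "T = tri_set u' v' w'"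
      using triangle_cover_classification[OF assms] by blast
    obtain g where g: "collineation g" "\<And>x y z. g (hpt ?e1 ?e2 ?e3 x y z) = hpt u' v' w' x y z"
      by (rule frame_change_collineation[OF f'], rule that)
    have "g ` ?S = T"
    proof (rule subset_antisym)
      show "g ` ?S \<subseteq> T"
      proof (rule image_subsetI)
        fix P assume "P \<in> ?S"
        then obtain x y z where p: "x \<noteq> 0 \<or> y \<noteq> 0 \<or> z \<noteq> 0" "tri_zero x y z" "P = hpt ?e1 ?e2 ?e3 x y z" by (rule tri_setE)
        show "g P \<in> T" unfolding p(3) g(2) T_eq hpt_in_tri_set_iff[OF f' p(1)] by (rule p(2))
      qed
      show "T \<subseteq> g ` ?S"
      proof
        fix P assume "P \<in> T"
        then obtain x y z where p: "x \<noteq> 0 \<or> y \<noteq> 0 \<or> z \<noteq> 0" "tri_zero x y z" "P = hpt u' v' w' x y z"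
          unfolding T_eq by (rule tri_setE)
        have "hpt ?e1 ?e2 ?e3 x y z \<in> ?S" using hpt_in_tri_set_iff[OF frame_axis p(1)] p(2) by simp
        moreover have "P = g (hpt ?e1 ?e2 ?e3 x y z)" using g(2) p(3) by simp
        ultimately show "P \<in> g ` ?S" by (rule rev_image_eqI)
      qed
    qed
    then show ?thesis unfolding proj_equivalent_def using g(1) by (intro exI[of _ g]) simp
  qed
  then show ?thesis
    using tri_set_redei[OF assms frame_axis] tri_set_index[OF assms frame_axis] card_tri_set[OF assms frame_axis]
    by (intro exI[of _ ?S]) simp
qed

end
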